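(* Let $d\ge1$, $\alpha,\ell>0$, $k\ge1$, and let $\boldsymbol{\alpha}=(\alpha,\dots,\alpha)$, $\boldsymbol{\ell}=(\ell,\dots,\ell)$ and $\boldsymbol{k}=(k,\dots,k)$, each with $d$ entries. Let $(Y_m)_{m=1}^\infty$ be a sequence of sets such that each $Y_m\subset(0,1)$ consists of $m$ distinct points and, for some constant $c_{\mathrm{qu}}>0$, $h_{Y_m,(0,1)}\le c_{\mathrm{qu}}m^{-1}$ for every $m\ge1$. For $p,q\in\mathbb{N}$ let $Y_p^{q,+}=\{x+q-1 : x\in Y_p\}$, $Y_p^{q,-}=\{x-q : x\in Y_p\}$, $$X_k=\bigcup_{m=1}^k\left(Y_{k-m+1}^{m,+}\cup Y_{k-m+1}^{m,-}\right),\qquad n=\#X_k=k(k+1),$$ and let $X_{\boldsymbol{k}}=X_k\times\cdots\times X_k\subset\mathbb{R}^d$ ($d$ factors). Let $\bar{h}_0=\min\{h_0(\ell),c_{\mathrm{qu}}^{-1}\}$, where $h_0(\ell)\in(0,1]$ is the constant fixed in the context. Then there is a positive constant $C$, which only depends on $\ell$, $\alpha$, $d$ and $c_{\mathrm{qu}}$, such that $$e_{\boldsymbol{\alpha},\boldsymbol{\ell}}(Q^{\mathrm{opt}}_{\boldsymbol{\alpha},\boldsymbol{\ell},X_{\boldsymbol{k}}})\le C\exp\left(-\frac{\sqrt{n}}{2\sqrt{2}\,\alpha^2}\right)$$ whenever $k\ge2c_{\mathrm{qu}}\bar{h}_0^{-1}$.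
   Context: For $\boldsymbol{\alpha},\boldsymbol{\ell}$ with positive elements: $I_{\boldsymbol{\alpha}}(f)=\int_{\mathbb{R}^d} f(\boldsymbol{x})\prod_{i=1}^d\left[\frac{1}{\sqrt{2\pi}\,\alpha_i}\exp(-x_i^2/(2\alpha_i^2))\right]d\boldsymbol{x}$; $K_{\boldsymbol{\ell}}(\boldsymbol{x},\boldsymbol{y})=\prod_{i=1}^d\exp(-(x_i-y_i)^2/(2\ell_i^2))$ is the Gaussian kernel on $\mathbb{R}^d$, with reproducing kernel Hilbert space $\mathcal{H}(K_{\boldsymbol{\ell}})$ and norm $\|\cdot\|_{\boldsymbol{\ell}}$. The worst-case error of an integration rule $Q$ is $e_{\boldsymbol{\alpha},\boldsymbol{\ell}}(Q)=\sup_{\|f\|_{\boldsymbol{\ell}}\le1}|I_{\boldsymbol{\alpha}}(f)-Q(f)|$. For a finite set $X=\{\boldsymbol{x}_1,\dots,\boldsymbol{x}_N\}\subset\mathbb{R}^d$ of distinct points, $Q^{\mathrm{opt}}_{\boldsymbol{\alpha},\boldsymbol{\ell},X}(f)=\sum_{i=1}^N w_i f(\boldsymbol{x}_i)$ is the rule on the points $X$ whose weights $(w_1,\dots,w_N)\in\mathbb{R}^N$ minimise the worst-case error $e_{\boldsymbol{\alpha},\boldsymbol{\ell}}$ among all weights in $\mathbb{R}^N$. In one dimension, with $K_\ell(x,y)=\exp(-(x-y)^2/(2\ell^2))$, the power function of a finite set $X\subset\mathbb{R}$ is $P_{\ell,X}(x)=\sup\{f(x) : f\in\mathcal{H}(K_\ell),\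 \|f\|_\ell\le1,\ f(x_i)=0\text{ for all }x_i\in X\}$. The fill-distance of a finite set $X$ on a bounded set $\Omega\subset\mathbb{R}$ is $h_{X,\Omega}=\sup_{x\in\Omega}\min_{x_i\in X\cap\Omega}|x-x_i|$, understood as $+\infty$ if $X\cap\Omega=\emptyset$ ($X$ need not be a subset of $\Omega$). For each $\ell>0$, fix constants $A(\ell)>0$ and $h_0(\ell)\in(0,1]$, depending only on $\ell$, such that for every closed interval $\Omega\subset\mathbb{R}$ of length $1$ and every finite set $X\subset\mathbb{R}$ of distinct points, $\int_\Omega P_{\ell,X}(x)\,dx\le\exp\left(A(\ell)\log(h_{X,\Omega})\,h_{X,\Omega}^{-1}\right)$ whenever $h_{X,\Omega}\le h_0(\ell)$; such constants exist. *)

theory Defs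
  imports "HOL-Analysis.Analysis"
begin

section \<open>Reproducing kernel Hilbert spaces of real functions\<close>

locale reproducing_kernel_hilbert_space =
  fixes K :: "'a \<Rightarrow> 'a \<Rightarrow> real"
    and H :: "('a \<Rightarrow> real) set"
    and ip :: "('a \<Rightarrow> real) \<Rightarrow> ('a \<Rightarrow> real) \<Rightarrow> real"
  assumes zero_mem: "(\<lambda>x. 0) \<in> H"
    and add_mem: "\<lbrakk>f \<in> H; g \<in> H\<rbrakk> \<Longrightarrow> (\<lambda>x. f x + g x) \<in> H"
    and scale_mem: "f \<in> H \<Longrightarrow> (\<lambda>x. c * f x) \<in> H"
    and ip_commute: "\<lbrakk>f \<in> H; g \<in> H\<rbrakk> \<Longrightarrow> ip f g = ip g f"
    and ip_add_left: "\<lbrakk>f \<in> H; g \<in> H; h \<in> H\<rbrakk> \<Longrightarrow> ip (\<lambda>x. f x + g x) h = ip f h + ip g h"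
    and ip_scale_left: "\<lbrakk>f \<in> H; g \<in> H\<rbrakk> \<Longrightarrow> ip (\<lambda>x. c * f x) g = c * ip f g"
    and ip_nonneg: "f \<in> H \<Longrightarrow> 0 \<le> ip f f"
    and ip_definite: "\<lbrakk>f \<in> H; ip f f = 0\<rbrakk> \<Longrightarrow> f = (\<lambda>x. 0)"
    and complete:
      "\<lbrakk>\<And>n. s n \<in> H;
        \<forall>e>0. \<exists>N. \<forall>m\<ge>N. \<forall>n\<ge>N. sqrt (ip (\<lambda>x. s m x - s n x) (\<lambda>x. s m x - s n x)) < e\<rbrakk>
       \<Longrightarrow> \<exists>f\<in>H. (\<lambda>n. sqrt (ip (\<lambda>x. s n x - f x) (\<lambda>x. s n x - f x))) \<longlonglongrightarrow> 0"
    and kernel_mem: "(\<lambda>x. K x y) \<in> H"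
    and reproducing: "f \<in> H \<Longrightarrow> ip f (\<lambda>x. K x y) = f y"

text \<open>
  For a positive semidefinite kernel such a space exists by the Moore--Aronszajn theorem; the
  set of functions is unique, and so is the inner product as a function on pairs of its
  elements. The choice therefore only affects irrelevant values of the inner product outside
  the space.
\<close>

definition rkhs :: "('a \<Rightarrow> 'a \<Rightarrow> real) \<Rightarrow>
    ('a \<Rightarrow> real) set \<times> (('a \<Rightarrow> real) \<Rightarrow> ('a \<Rightarrow> real) \<Rightarrow> real)" where
  "rkhs K = (SOME R. reproducing_kernel_hilbert_space K (fst R) (snd R))"

definition rkhs_space :: "('a \<Rightarrow> 'a \<Rightarrow> real) \<Rightarrow> ('a \<Rightarrow> real) set" where
  "rkhs_space K = fst (rkhs K)"

definition rkhs_norm :: "('a \<Rightarrow> 'a \<Rightarrow> real) \<Rightarrow> ('a \<Rightarrow> real) \<Rightarrow> real" where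
  "rkhs_norm K f = sqrt (snd (rkhs K) f f)"


section \<open>Gaussian kernels and Gaussian integration\<close>

definition gauss_kernel1 :: "real \<Rightarrow> real \<Rightarrow> real \<Rightarrow> real" where
  "gauss_kernel1 l x y = exp (- (x - y)\<^sup>2 / (2 * l\<^sup>2))"

definition gauss_kernel :: "real ^ 'd \<Rightarrow> real ^ 'd \<Rightarrow> real ^ 'd \<Rightarrow> real" where
  "gauss_kernel l x y = (\<Prod>i\<in>UNIV. exp (- (x $ i - y $ i)\<^sup>2 / (2 * (l $ i)\<^sup>2)))"

definition gauss_integral :: "real ^ 'd \<Rightarrow> (real ^ 'd \<Rightarrow> real) \<Rightarrow> real" where
  "gauss_integral \<alpha> f = integral\<^sup>L lborel
     (\<lambda>x. f x * (\<Prod>i\<in>UNIV. 1 / (sqrt (2 * pi) * \<alpha> $ i) * exp (- (x $ i)\<^sup>2 / (2 * (\<alpha> $ i)\<^sup>2))))"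

text \<open>
  The suprema below are taken over nonempty bounded sets of reals when the length-scales and
  standard deviations are positive, because
  \<open>\<bar>f x\<bar> \<le> \<parallel>f\<parallel> * sqrt (K x x) = \<parallel>f\<parallel>\<close> for Gaussian kernels.
\<close>

definition worst_case_error ::
    "real ^ 'd \<Rightarrow> real ^ 'd \<Rightarrow> ((real ^ 'd \<Rightarrow> real) \<Rightarrow> real) \<Rightarrow> real" where
  "worst_case_error \<alpha> l Q =
     (SUP f \<in> {f \<in> rkhs_space (gauss_kernel l). rkhs_norm (gauss_kernel l) f \<le> 1}.
        \<bar>gauss_integral \<alpha> f - Q f\<bar>)"

definition power_function :: "real \<Rightarrow> real set \<Rightarrow> real \<Rightarrow> real" where
  "power_function l X x =
     (SUP f \<in> {f \<in> rkhs_space (gauss_kernel1 l).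
                rkhs_norm (gauss_kernel1 l) f \<le> 1 \<and> (\<forall>y\<in>X. f y = 0)}. f x)"


section \<open>Optimal quadrature rules\<close>

text \<open>Weights are indexed by the points themselves; their values outside the point set play no role.\<close>

definition quad_rule :: "'a set \<Rightarrow> ('a \<Rightarrow> real) \<Rightarrow> ('a \<Rightarrow> real) \<Rightarrow> real" where
  "quad_rule X w f = (\<Sum>x\<in>X. w x * f x)"

definition opt_rule ::
    "real ^ 'd \<Rightarrow> real ^ 'd \<Rightarrow> (real ^ 'd) set \<Rightarrow> (real ^ 'd \<Rightarrow> real) \<Rightarrow> real" where
  "opt_rule \<alpha> l X =
     quad_rule X (ARG_MIN (\<lambda>w. worst_case_error \<alpha> l (quad_rule X w)) w. True)"


section \<open>Point sets\<close>

definition fill_distance :: "real set \<Rightarrow> real set \<Rightarrow> ereal" where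
  "fill_distance X \<Omega> =
     (if X \<inter> \<Omega> = {} then \<infinity>
      else (SUP x\<in>\<Omega>. ereal (Min ((\<lambda>y. \<bar>x - y\<bar>) ` (X \<inter> \<Omega>)))))"

definition shift_pos :: "(nat \<Rightarrow> real set) \<Rightarrow> nat \<Rightarrow> nat \<Rightarrow> real set" where
  "shift_pos Y p q = (\<lambda>x. x + real q - 1) ` Y p"

definition shift_neg :: "(nat \<Rightarrow> real set) \<Rightarrow> nat \<Rightarrow> nat \<Rightarrow> real set" where
  "shift_neg Y p q = (\<lambda>x. x - real q) ` Y p"

definition nodes :: "(nat \<Rightarrow> real set) \<Rightarrow> nat \<Rightarrow> real set" where
  "nodes Y k = (\<Union>m\<in>{1..k}. shift_pos Y (k - m + 1) m \<union> shift_neg Y (k - m + 1) m)"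

definition grid :: "real set \<Rightarrow> (real ^ 'd) set" where
  "grid X = {x. \<forall>i. x $ i \<in> X}"

definition admissible_sequence :: "real \<Rightarrow> (nat \<Rightarrow> real set) \<Rightarrow> bool" where
  "admissible_sequence c Y \<longleftrightarrow>
     (\<forall>m\<ge>1. Y m \<subseteq> {0<..<1} \<and> finite (Y m) \<and> card (Y m) = m \<and>
            fill_distance (Y m) {0<..<1} \<le> ereal (c / real m))"

end

theory Submission
  imports Defs "HOL-Complex_Analysis.Cauchy_Integral_Formula" "HOL-Probability.Distributions"
    "HOL-Real_Asymp.Real_Asymp"
begin

text \<open>
  Write \<open>\<mu>\<close> for the one-dimensional Gaussian measure, \<open>m\<close> for its representer (mean embedding) in the
  one-dimensional Hilbert space, and \<open>p\<close> for the orthogonal projection of \<open>m\<close> onto the span of the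
  kernel functions at the nodes. The residual \<open>m - p\<close> vanishes at the nodes, so
  \<open>\<parallel>m - p\<parallel>\<^sup>2 = \<integral> (m - p) d\<mu> \<le> \<parallel>m - p\<parallel> \<integral> P d\<mu>\<close> with \<open>P\<close> the power function. In dimension \<open>d\<close>,
  the product weights give squared error \<open>\<parallel>m\<parallel>\<^bsup>2d\<^esup> - \<parallel>p\<parallel>\<^bsup>2d\<^esup> \<le> d \<parallel>m - p\<parallel>\<^sup>2\<close>, and the optimal weights
  can only do better; hence the error is at most \<open>\<surd>d \<integral> P d\<mu>\<close>.

  For the last integral, the unit intervals within distance \<open>k / 2\<close> of the origin have fill distance
  at most \<open>2c / k\<close>, where the power function is superexponentially small in \<open>k\<close>, and
  outside of them \<open>P \<le> 1\<close> while the Gaussian mass is of order \<open>exp (- const \<cdot> k\<^sup>2)\<close>.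

  The Gaussian Hilbert spaces are realised by the features
  \<open>exp (- x\<^sup>2 / (2 l\<^sup>2)) (x / l)\<^sup>n / \<surd>(n!)\<close> and their tensor products, which are independent over the
  square-summable sequences because a power series determines its coefficients.
\<close>

section \<open>Geometry of reproducing kernel Hilbert spaces\<close>

context reproducing_kernel_hilbert_space
begin

section \<open>Arithmetic of the inner product and Cauchy-Schwarz\<close>

lemma diff_mem: "\<lbrakk>f \<in> H; g \<in> H\<rbrakk> \<Longrightarrow> (\<lambda>x. f x - g x) \<in> H"
  using add_mem[OF _ scale_mem, of f g "-1"] by simp

lemma sum_mem: "(\<And>i. i \<in> I \<Longrightarrow> F i \<in> H) \<Longrightarrow> (\<lambda>x. \<Sum>i\<in>I. w i * F i x) \<in> H"
proof (induction I rule: infinite_finite_induct)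
  case (insert i I)
  have "(\<lambda>x. w i * F i x + (\<Sum>i\<in>I. w i * F i x)) \<in> H"
    using insert by (intro add_mem scale_mem) auto
  with insert show ?case by simp
qed (auto simp: zero_mem)

lemma ip_add_right: "\<lbrakk>f \<in> H; g \<in> H; h \<in> H\<rbrakk> \<Longrightarrow> ip h (\<lambda>x. f x + g x) = ip h f + ip h g"
  using ip_add_left[of f g h] by (simp add: ip_commute[of h] add_mem)

lemma ip_scale_right: "\<lbrakk>f \<in> H; g \<in> H\<rbrakk> \<Longrightarrow> ip g (\<lambda>x. c * f x) = c * ip g f"
  using ip_scale_left[of f g c] by (simp add: ip_commute[of g] scale_mem)

lemma ip_diff_left: "\<lbrakk>f \<in> H; g \<in> H; h \<in> H\<rbrakk> \<Longrightarrow> ip (\<lambda>x. f x - g x) h = ip f h - ip g h"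
  using ip_add_left[OF _ scale_mem, of f g h "-1"] ip_scale_left[of g h "-1"] by simp

lemma ip_diff_right: "\<lbrakk>f \<in> H; g \<in> H; h \<in> H\<rbrakk> \<Longrightarrow> ip h (\<lambda>x. f x - g x) = ip h f - ip h g"
  using ip_diff_left[of f g h] by (simp add: ip_commute[of h] diff_mem)

lemma ip_zero_left: "f \<in> H \<Longrightarrow> ip (\<lambda>x. 0) f = 0"
  using ip_scale_left[OF zero_mem, of f 0] by simp

lemma ip_sum_right:
  "\<lbrakk>\<And>i. i \<in> I \<Longrightarrow> F i \<in> H; f \<in> H\<rbrakk> \<Longrightarrow> ip f (\<lambda>x. \<Sum>i\<in>I. w i * F i x) = (\<Sum>i\<in>I. w i * ip f (F i))"
proof (induction I rule: infinite_finite_induct)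
  case (insert i I)
  have "ip f (\<lambda>x. w i * F i x + (\<Sum>i\<in>I. w i * F i x)) = w i * ip f (F i) + (\<Sum>i\<in>I. w i * ip f (F i))"
    using insert by (subst ip_add_right) (auto intro!: scale_mem sum_mem simp: ip_scale_right)
  with insert show ?case by simp
qed (auto simp: ip_zero_left ip_commute[OF _ zero_mem])

lemma ip_add_scale_self:
  assumes "f \<in> H" "g \<in> H"
  shows "ip (\<lambda>x. f x + c * g x) (\<lambda>x. f x + c * g x) = ip f f + 2 * c * ip f g + c\<^sup>2 * ip g g"
  using assms
  by (simp add: ip_add_left ip_add_right add_mem scale_mem ip_scale_left ip_scale_right
      ip_commute[of g f] power2_eq_square algebra_simps)

lemma ip_diff_self:
  assumes "f \<in> H" "g \<in> H"
  shows "ip (\<lambda>x. f x - g x) (\<lambda>x. f x - g x) = ip f f - 2 * ip f g + ip g g"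
  using ip_add_scale_self[OF assms, of "-1"] by simp

lemma Cauchy_Schwarz_sq:
  assumes "f \<in> H" "g \<in> H"
  shows "(ip f g)\<^sup>2 \<le> ip f f * ip g g"
proof (cases "ip g g = 0")
  case True
  then show ?thesis
    using assms ip_definite[of g] by (simp add: ip_zero_left ip_commute[OF _ zero_mem])
next
  case False
  with ip_nonneg[OF assms(2)] have pos: "ip g g > 0" by simp
  have "0 \<le> ip (\<lambda>x. f x + (- (ip f g / ip g g)) * g x) (\<lambda>x. f x + (- (ip f g / ip g g)) * g x)"
    by (intro ip_nonneg add_mem scale_mem assms)
  also have "\<dots> = ip f f - (ip f g)\<^sup>2 / ip g g"
    unfolding ip_add_scale_self[OF assms] using pos by (simp add: field_simps power2_eq_square)
  finally show ?thesis using pos by (simp add: field_simps)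
qed

lemma Cauchy_Schwarz:
  assumes "f \<in> H" "g \<in> H"
  shows "\<bar>ip f g\<bar> \<le> sqrt (ip f f) * sqrt (ip g g)"
proof -
  have "\<bar>ip f g\<bar> = sqrt ((ip f g)\<^sup>2)" by simp
  also have "\<dots> \<le> sqrt (ip f f * ip g g)"
    by (rule real_sqrt_le_mono[OF Cauchy_Schwarz_sq[OF assms]])
  finally show ?thesis by (simp add: real_sqrt_mult)
qed

section \<open>Pointwise consequences of the reproducing property\<close>

lemma kernel_commute: "K x y = K y x"
  using reproducing[OF kernel_mem, of x y] reproducing[OF kernel_mem, of y x]
    ip_commute[OF kernel_mem kernel_mem, of x y] by simp

lemma ip_kernel_comb:
  assumes "f \<in> H"
  shows "ip f (\<lambda>y. \<Sum>x\<in>X. w x * K y x) = (\<Sum>x\<in>X. w x * f x)"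
  by (subst ip_sum_right) (auto simp: kernel_mem assms reproducing)

lemma pointwise_bound: "f \<in> H \<Longrightarrow> \<bar>f x\<bar> \<le> sqrt (ip f f) * sqrt (K x x)"
  using Cauchy_Schwarz[OF _ kernel_mem, of f x] by (simp add: reproducing kernel_mem)

lemma pointwise_diff_bound:
  assumes "f \<in> H"
  shows "\<bar>f x - f y\<bar> \<le> sqrt (ip f f) * sqrt (K x x - 2 * K x y + K y y)"
  using Cauchy_Schwarz[OF assms diff_mem[OF kernel_mem kernel_mem], of x y] assms
  by (simp add: ip_diff_right ip_diff_self kernel_mem reproducing kernel_commute[of y x])

theorem Riesz_representation:
  assumes L_add: "\<And>f g. \<lbrakk>f \<in> H; g \<in> H\<rbrakk> \<Longrightarrow> L (\<lambda>x. f x + g x) = L f + L g"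
    and L_scale: "\<And>c f. f \<in> H \<Longrightarrow> L (\<lambda>x. c * f x) = c * L f"
    and L_bound: "\<And>f. f \<in> H \<Longrightarrow> (L f)\<^sup>2 \<le> M * ip f f"
    and "0 \<le> M"
  obtains r where "r \<in> H" "\<And>f. f \<in> H \<Longrightarrow> L f = ip f r"
proof -
  \<comment> \<open>The representer is the minimiser of \<open>\<parallel>f\<parallel>\<^sup>2 - 2 L f\<close>; by the parallelogram law,
    minimising sequences are Cauchy.\<close>
  define J where "J f = ip f f - 2 * L f" for f
  have J_lower: "- M \<le> J f" if "f \<in> H" for f
  proof -
    have "(2 * L f)\<^sup>2 \<le> 4 * (M * ip f f)"
      using L_bound[OF that] by (simp add: power_mult_distrib)
    also have "\<dots> \<le> (M + ip f f)\<^sup>2"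
      using zero_le_power2[of "M - ip f f"] by (simp add: power2_eq_square algebra_simps)
    finally have "\<bar>2 * L f\<bar> \<le> M + ip f f"
      using \<open>0 \<le> M\<close> ip_nonneg[OF that] by (simp only: abs_le_square_iff[symmetric])
    then show ?thesis by (simp add: J_def)
  qed
  define J0 where "J0 = Inf (J ` H)"
  have bdd: "bdd_below (J ` H)" using J_lower by (intro bdd_belowI2[where m="- M"])
  have J0_le: "J0 \<le> J f" if "f \<in> H" for f
    unfolding J0_def using bdd that by (auto intro: cInf_lower)
  have "\<exists>f\<in>H. J f < J0 + 1 / real (Suc n)" for n
    using cInf_lessD[of "J ` H" "J0 + 1 / real (Suc n)"] zero_mem by (auto simp: J0_def)
  then obtain s where s_mem: "\<And>n. s n \<in> H" and s_less: "\<And>n. J (s n) < J0 + 1 / real (Suc n)"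
    by metis
  have parallelogram: "ip (\<lambda>x. f x - g x) (\<lambda>x. f x - g x) \<le> 2 * (J f + J g - 2 * J0)"
    if "f \<in> H" "g \<in> H" for f g
  proof -
    let ?m = "\<lambda>x. (1/2) * (f x + 1 * g x)"
    have fg: "(\<lambda>x. f x + 1 * g x) \<in> H" using that by (intro add_mem scale_mem)
    have "J0 \<le> J ?m" by (intro J0_le scale_mem fg)
    also have "ip ?m ?m = (ip f f + 2 * ip f g + ip g g) / 4"
      using ip_add_scale_self[OF that, of 1]
      by (simp only: ip_scale_left[OF fg scale_mem[OF fg]] ip_scale_right[OF fg fg]) simp
    then have "J ?m = (ip f f + 2 * ip f g + ip g g) / 4 - (L f + L g)"
      using L_scale[OF fg, of "1/2"] L_add[OF that] by (simp add: J_def field_simps)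
    finally show ?thesis by (simp add: J_def ip_diff_self[OF that] field_simps)
  qed
  have "\<forall>e>0. \<exists>N. \<forall>m\<ge>N. \<forall>n\<ge>N. sqrt (ip (\<lambda>x. s m x - s n x) (\<lambda>x. s m x - s n x)) < e"
  proof (intro allI impI)
    fix e :: real assume "0 < e"
    \<comment> \<open>Two functions whose values of \<open>J\<close> are within e^2 / 4 of the
      infimum are at squared distance less than e^2, since the parallelogram bound is twice the sum
      of the two excesses.\<close>
    obtain N where N: "1 / real (Suc N) < e\<^sup>2 / 4"
      using reals_Archimedean[of "e\<^sup>2 / 4"] \<open>0 < e\<close> by (auto simp: inverse_eq_divide)
    have "sqrt (ip (\<lambda>x. s m x - s n x) (\<lambda>x. s m x - s n x)) < e" if "m \<ge> N" "n \<ge> N" for m n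
    proof -
      have "1 / real (Suc m) \<le> 1 / real (Suc N)" "1 / real (Suc n) \<le> 1 / real (Suc N)"
        using that by (auto intro!: divide_left_mono)
      moreover have "a < b" if "a \<le> 2 * (p + q - 2 * J0)" "p < J0 + u" "q < J0 + v"
        "u \<le> w" "v \<le> w" "w < b / 4" for a b p q u v w :: real
        using that by (simp add: field_simps)
      ultimately have "ip (\<lambda>x. s m x - s n x) (\<lambda>x. s m x - s n x) < e\<^sup>2"
        using parallelogram[OF s_mem s_mem] s_less N by blast
      then show ?thesis using real_sqrt_less_mono[of _ "e\<^sup>2"] \<open>0 < e\<close> by simp
    qed
    then show "\<exists>N. \<forall>m\<ge>N. \<forall>n\<ge>N. sqrt (ip (\<lambda>x. s m x - s n x) (\<lambda>x. s m x - s n x)) < e"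
      by blast
  qed
  from complete[OF s_mem this] obtain r where r_mem: "r \<in> H"
    and r_lim: "(\<lambda>n. sqrt (ip (\<lambda>x. s n x - r x) (\<lambda>x. s n x - r x))) \<longlonglongrightarrow> 0" by blast
  have "L f = ip f r" if "f \<in> H" for f
  proof -
    have "(\<lambda>n. ip (s n) f - ip r f) \<longlonglongrightarrow> 0"
    proof (rule Lim_null_comparison)
      show "\<forall>\<^sub>F n in sequentially. norm (ip (s n) f - ip r f)
          \<le> sqrt (ip (\<lambda>x. s n x - r x) (\<lambda>x. s n x - r x)) * sqrt (ip f f)"
        using Cauchy_Schwarz[OF diff_mem[OF s_mem r_mem] that]
        by (simp add: ip_diff_left s_mem r_mem that)
      show "(\<lambda>n. sqrt (ip (\<lambda>x. s n x - r x) (\<lambda>x. s n x - r x)) * sqrt (ip f f)) \<longlonglongrightarrow> 0"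
        using tendsto_mult_right[OF r_lim, of "sqrt (ip f f)"] by simp
    qed
    then have lim: "(\<lambda>n. ip (s n) f) \<longlonglongrightarrow> ip r f" by (rule LIM_zero_cancel)
    \<comment> \<open>First variation: moving \<open>s n\<close> along \<open>f\<close> can lower
      \<open>J\<close> by less than 1 / (n + 1), so in the limit the quadratic increment at
      \<open>r\<close> is nonnegative for every t.\<close>
    have quad: "0 \<le> 2 * t * (ip r f - L f) + t\<^sup>2 * ip f f" for t
    proof -
      have "0 \<le> 1 / real (Suc n) + (2 * t * (ip (s n) f - L f) + t\<^sup>2 * ip f f)" for n
      proof -
        have "J0 \<le> J (\<lambda>x. s n x + t * f x)" by (intro J0_le add_mem scale_mem s_mem that)
        also have "\<dots> = J (s n) + (2 * t * (ip (s n) f - L f) + t\<^sup>2 * ip f f)"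
          using L_add[OF s_mem[of n] scale_mem[OF that, of t]] L_scale[OF that, of t]
          by (simp add: J_def ip_add_scale_self[OF s_mem that] algebra_simps)
        finally show ?thesis using s_less[of n] by simp
      qed
      moreover have "(\<lambda>n. 1 / real (Suc n) + (2 * t * (ip (s n) f - L f) + t\<^sup>2 * ip f f))
          \<longlonglongrightarrow> 0 + (2 * t * (ip r f - L f) + t\<^sup>2 * ip f f)"
        by (intro tendsto_intros lim LIMSEQ_Suc[OF lim_1_over_n])
      ultimately show ?thesis using LIMSEQ_le_const by fastforce
    qed
    define d where "d = ip r f - L f"
    have "d = 0"
    proof (rule ccontr)
      assume "d \<noteq> 0"
      \<comment> \<open>The added 1 keeps \<open>q\<close> positive even for f = 0, so that t = - d
        / q is a legitimate step; it makes the quadratic strictly negative.\<close>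
      define q where "q = ip f f + 1"
      have q: "q > 0" using ip_nonneg[OF that] by (simp add: q_def)
      have "0 \<le> 2 * (- d / q) * d + (- d / q)\<^sup>2 * (q - 1)"
        using quad[of "- d / q"] by (simp add: d_def q_def)
      also have "\<dots> = - (d\<^sup>2 / q) - (d / q)\<^sup>2"
        using q by (simp add: power2_eq_square field_simps)
      also have "\<dots> < 0"
        using \<open>d \<noteq> 0\<close> q add_pos_pos[of "d\<^sup>2 / q" "(d / q)\<^sup>2"] by simp
      finally show False by simp
    qed
    then show ?thesis by (simp add: d_def ip_commute[OF that r_mem])
  qed
  with r_mem that show ?thesis by blast
qed


text \<open>Interpolation stays solvable when the Gram matrix is singular, because the data come
  from \<open>H\<close>: if the kernel at a new point z depends linearly on the kernels at X, every
  member of \<open>H\<close> vanishing on X vanishes at z too.\<close>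

lemma kernel_interpolation:
  assumes "finite X" "g \<in> H"
  obtains w where "\<And>y. y \<in> X \<Longrightarrow> (\<Sum>x\<in>X. w x * K y x) = g y"
proof -
  have "\<forall>g\<in>H. \<exists>w. \<forall>y\<in>X. (\<Sum>x\<in>X. w x * K y x) = g y"
    using assms(1)
  proof (induction X)
    case (insert z X)
    show ?case
    proof
      fix g assume g: "g \<in> H"
      obtain u where u: "\<forall>y\<in>X. (\<Sum>x\<in>X. u x * K y x) = g y"
        using insert.IH g by blast
      obtain v where v: "\<forall>y\<in>X. (\<Sum>x\<in>X. v x * K y x) = K y z"
        using bspec[OF insert.IH kernel_mem[of z]] by blast
      \<comment> \<open>\<open>q\<close> is the part of the kernel at z orthogonal to the kernels at
        X. Against functions vanishing on X it acts as evaluation at z; in particular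
        \<open>q z\<close> is its squared norm.\<close>
      define q where "q = (\<lambda>y. K y z - (\<Sum>x\<in>X. v x * K y x))"
      have q_mem: "q \<in> H" unfolding q_def by (intro diff_mem kernel_mem sum_mem)
      define r where "r = (\<lambda>y. g y - (\<Sum>x\<in>X. u x * K y x))"
      have r_mem: "r \<in> H" unfolding r_def by (intro diff_mem kernel_mem sum_mem g)
      have ip_q: "ip f q = f z" if "f \<in> H" "\<forall>y\<in>X. f y = 0" for f
        unfolding q_def using that
        by (simp add: ip_diff_right kernel_mem sum_mem reproducing ip_kernel_comb)
      show "\<exists>w. \<forall>y\<in>insert z X. (\<Sum>x\<in>insert z X. w x * K y x) = g y"
      proof (cases "q z = 0")
        case True
        have "ip q q = q z" using q_mem v by (intro ip_q) (auto simp: q_def)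
        with True have "q = (\<lambda>x. 0)" using ip_definite[OF q_mem] by simp
        moreover have "ip r q = r z" using r_mem u by (intro ip_q) (auto simp: r_def)
        ultimately have "r z = 0" using ip_zero_left[OF r_mem] ip_commute[OF r_mem zero_mem] by simp
        then have "\<forall>y\<in>insert z X. (\<Sum>x\<in>X. u x * K y x) = g y" using u by (auto simp: r_def)
        moreover have "(\<Sum>x\<in>insert z X. (u(z := 0)) x * K y x) = (\<Sum>x\<in>X. u x * K y x)" for y
          using insert.hyps by (auto intro!: sum.cong)
        ultimately show ?thesis by metis
      next
        case False
        \<comment> \<open>Newton-type update: adding a multiple of \<open>q\<close> leaves the
          values on X unchanged, and this multiple removes the error at z.\<close>
        define t where "t = r z / q z"
        define w where "w x = (if x = z then t else u x - t * v x)" for x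
        have w: "(\<Sum>x\<in>insert z X. w x * K y x) = g y - r y + t * q y" for y
        proof -
          have "(\<Sum>x\<in>X. w x * K y x) = (\<Sum>x\<in>X. u x * K y x - t * (v x * K y x))"
            using insert.hyps by (intro sum.cong) (auto simp: w_def algebra_simps)
          then show ?thesis
            using insert.hyps
            by (simp add: w_def r_def q_def sum_subtractf sum_distrib_left algebra_simps)
        qed
        have "(\<Sum>x\<in>insert z X. w x * K y x) = g y" if "y \<in> insert z X" for y
          using that u v False unfolding w by (auto simp: r_def q_def t_def)
        then show ?thesis by blast
      qed
    qed
  qed simp
  with assms(2) that show ?thesis by blast
qed

text \<open>If \<open>r\<close> represents an integration functional, this function represents the
  error of the rule with nodes X and weights w.\<close>

abbreviation kernel_residual :: "('a \<Rightarrow> real) \<Rightarrow> 'a set \<Rightarrow> ('a \<Rightarrow> real) \<Rightarrow> 'a \<Rightarrow> real" where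
  "kernel_residual r X w \<equiv> (\<lambda>y. r y - (\<Sum>x\<in>X. w x * K y x))"

lemma kernel_residual_mem: "r \<in> H \<Longrightarrow> kernel_residual r X w \<in> H"
  by (intro diff_mem sum_mem kernel_mem)

lemma ip_kernel_residual:
  assumes "r \<in> H"
  shows "ip (kernel_residual r X w) (kernel_residual r X w) =
    ip r r - 2 * (\<Sum>x\<in>X. w x * r x) + (\<Sum>x\<in>X. \<Sum>y\<in>X. w x * w y * K x y)"
  using assms
  by (simp add: ip_diff_self sum_mem kernel_mem ip_kernel_comb sum_distrib_left mult.assoc)

text \<open>Pythagoras: a residual vanishing on X is orthogonal to all combinations of kernels at X,
  and any other residual differs from it by such a combination.\<close>

lemma orthogonal_weights:
  assumes "r \<in> H" "finite X"
  obtains w where "\<And>y. y \<in> X \<Longrightarrow> kernel_residual r X w y = 0"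
    "\<And>v. ip (kernel_residual r X w) (kernel_residual r X w)
        \<le> ip (kernel_residual r X v) (kernel_residual r X v)"
proof -
  obtain w where w: "\<And>y. y \<in> X \<Longrightarrow> (\<Sum>x\<in>X. w x * K y x) = r y"
    using kernel_interpolation[OF assms(2,1)] by blast
  have "ip (kernel_residual r X w) (kernel_residual r X w)
        \<le> ip (kernel_residual r X v) (kernel_residual r X v)" for v
  proof -
    define q where "q = (\<lambda>y. \<Sum>x\<in>X. (w x - v x) * K y x)"
    have q_mem: "q \<in> H" unfolding q_def by (intro sum_mem kernel_mem)
    have split: "kernel_residual r X v = (\<lambda>y. kernel_residual r X w y + 1 * q y)"
      by (simp add: q_def fun_eq_iff left_diff_distrib sum_subtractf)
    have "ip (kernel_residual r X w) q = 0"
      unfolding q_def ip_kernel_comb[OF kernel_residual_mem[OF assms(1)]] using w by simp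
    then show ?thesis
      unfolding split ip_add_scale_self[OF kernel_residual_mem[OF assms(1)] q_mem]
      using ip_nonneg[OF q_mem] by simp
  qed
  moreover have "kernel_residual r X w y = 0" if "y \<in> X" for y using w[OF that] by simp
  ultimately show ?thesis by (rule that[rotated])
qed

text \<open>The error is the inner product with the residual, and Cauchy-Schwarz is sharp at the
  normalised residual.\<close>

lemma SUP_quadrature_error:
  assumes r: "r \<in> H" "\<And>f. f \<in> H \<Longrightarrow> L f = ip f r"
  shows "(SUP f\<in>{f \<in> H. sqrt (ip f f) \<le> 1}. \<bar>L f - (\<Sum>x\<in>X. w x * f x)\<bar>) =
    sqrt (ip (kernel_residual r X w) (kernel_residual r X w))"
proof -
  let ?R = "kernel_residual r X w"
  let ?B = "{f \<in> H. sqrt (ip f f) \<le> 1}"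
  let ?n = "sqrt (ip ?R ?R)"
  have R_mem: "?R \<in> H" by (rule kernel_residual_mem[OF r(1)])
  have err: "L f - (\<Sum>x\<in>X. w x * f x) = ip f ?R" if "f \<in> H" for f
    using that r by (simp add: ip_diff_right sum_mem kernel_mem ip_kernel_comb)
  have n_nonneg: "0 \<le> ?n" using ip_nonneg[OF R_mem] by simp
  have upper: "\<bar>L f - (\<Sum>x\<in>X. w x * f x)\<bar> \<le> ?n" if "f \<in> ?B" for f
  proof -
    have "\<bar>ip f ?R\<bar> \<le> sqrt (ip f f) * ?n" using that R_mem by (intro Cauchy_Schwarz) auto
    also have "\<dots> \<le> 1 * ?n" using that n_nonneg by (intro mult_right_mono) auto
    finally show ?thesis using that err[of f] by simp
  qed
  show ?thesis
  proof (rule antisym)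
    have "(\<lambda>x. 0) \<in> ?B" using zero_mem ip_zero_left[OF zero_mem] by simp
    then show "(SUP f\<in>?B. \<bar>L f - (\<Sum>x\<in>X. w x * f x)\<bar>) \<le> ?n"
      using upper by (intro cSUP_least) blast+
    have bdd: "bdd_above ((\<lambda>f. \<bar>L f - (\<Sum>x\<in>X. w x * f x)\<bar>) ` ?B)"
      using upper by (intro bdd_aboveI2)
    \<comment> \<open>Since division by zero gives 0, this is the zero function when the residual
      has norm zero, and it attains the supremum in that case as well.\<close>
    let ?f = "\<lambda>x. (1 / ?n) * ?R x"
    have f_mem: "?f \<in> H" by (intro scale_mem R_mem)
    have nn: "?n * ?n = ip ?R ?R" using ip_nonneg[OF R_mem] by simp
    have "ip ?f ?f = (1 / ?n) * (1 / ?n) * ip ?R ?R"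
      using ip_scale_left[OF R_mem f_mem, of "1 / ?n"] ip_scale_right[OF R_mem R_mem, of "1 / ?n"]
      by simp
    also have "\<dots> \<le> 1" using nn by (cases "?n = 0") (auto simp: field_simps)
    finally have fB: "?f \<in> ?B" using f_mem by simp
    have "ip ?f ?R = (1 / ?n) * ip ?R ?R" by (rule ip_scale_left[OF R_mem R_mem])
    also have "\<dots> = ?n" using ip_nonneg[OF R_mem] by (simp add: real_div_sqrt)
    finally have "ip ?f ?R = ?n" .
    then have "?n = \<bar>L ?f - (\<Sum>x\<in>X. w x * ?f x)\<bar>" using err[OF f_mem] n_nonneg by simp
    also have "\<dots> \<le> (SUP f\<in>?B. \<bar>L f - (\<Sum>x\<in>X. w x * f x)\<bar>)"
      by (rule cSUP_upper[OF fB bdd])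
    finally show "?n \<le> (SUP f\<in>?B. \<bar>L f - (\<Sum>x\<in>X. w x * f x)\<bar>)" .
  qed
qed

section \<open>The extremal problem behind the power function\<close>

definition vanishing_ball :: "'a set \<Rightarrow> ('a \<Rightarrow> real) set" where
  "vanishing_ball X = {f \<in> H. sqrt (ip f f) \<le> 1 \<and> (\<forall>y\<in>X. f y = 0)}"

lemma zero_in_vanishing_ball: "(\<lambda>x. 0) \<in> vanishing_ball X"
  using zero_mem ip_zero_left[OF zero_mem] by (simp add: vanishing_ball_def)

lemma vanishing_ball_nonempty: "vanishing_ball X \<noteq> {}"
  using zero_in_vanishing_ball by blast

lemma vanishing_ball_bound:
  assumes "f \<in> vanishing_ball X"
  shows "\<bar>f x\<bar> \<le> sqrt (K x x)" "\<bar>f x - f y\<bar> \<le> sqrt (K x x - 2 * K x y + K y y)"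
proof -
  have f: "f \<in> H" "sqrt (ip f f) \<le> 1" using assms by (auto simp: vanishing_ball_def)
  have "0 \<le> K x x" using ip_nonneg[OF kernel_mem, of x] by (simp add: reproducing kernel_mem)
  then have "sqrt (ip f f) * sqrt (K x x) \<le> 1 * sqrt (K x x)"
    using f by (intro mult_right_mono) auto
  with pointwise_bound[OF f(1), of x] show "\<bar>f x\<bar> \<le> sqrt (K x x)" by simp
  have "0 \<le> K x x - 2 * K x y + K y y"
    using ip_nonneg[OF diff_mem[OF kernel_mem kernel_mem], of x y]
    by (simp add: ip_diff_self kernel_mem reproducing kernel_commute[of y x])
  then have "sqrt (ip f f) * sqrt (K x x - 2 * K x y + K y y) \<le> 1 * sqrt (K x x - 2 * K x y + K y y)"
    using f by (intro mult_right_mono) auto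
  with pointwise_diff_bound[OF f(1), of x y]
  show "\<bar>f x - f y\<bar> \<le> sqrt (K x x - 2 * K x y + K y y)" by simp
qed

lemma bdd_above_vanishing_ball: "bdd_above ((\<lambda>f. f x) ` vanishing_ball X)"
proof (rule bdd_aboveI2)
  show "f x \<le> sqrt (K x x)" if "f \<in> vanishing_ball X" for f
    using vanishing_ball_bound(1)[OF that, of x] by simp
qed

lemma SUP_vanishing_ball_bounds:
  "0 \<le> (SUP f\<in>vanishing_ball X. f x)" "(SUP f\<in>vanishing_ball X. f x) \<le> sqrt (K x x)"
proof -
  from cSUP_upper[OF zero_in_vanishing_ball bdd_above_vanishing_ball] show "0 \<le> (SUP f\<in>vanishing_ball X. f x)" .
  show "(SUP f\<in>vanishing_ball X. f x) \<le> sqrt (K x x)"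
  proof (intro cSUP_least vanishing_ball_nonempty)
    show "f x \<le> sqrt (K x x)" if "f \<in> vanishing_ball X" for f
      using vanishing_ball_bound(1)[OF that, of x] by simp
  qed
qed

text \<open>All members of the ball share the kernel distance as a modulus of continuity, and a
  supremum inherits a common modulus. Measurability of the power function comes from here.\<close>

lemma SUP_vanishing_ball_diff:
  "\<bar>(SUP f\<in>vanishing_ball X. f x) - (SUP f\<in>vanishing_ball X. f y)\<bar>
    \<le> sqrt (K x x - 2 * K x y + K y y)"
proof -
  have "(SUP f\<in>vanishing_ball X. f x) \<le> (SUP f\<in>vanishing_ball X. f y) + sqrt (K x x - 2 * K x y + K y y)"
    for x y
  proof (intro cSUP_least vanishing_ball_nonempty)
    fix f assume f: "f \<in> vanishing_ball X"
    show "f x \<le> (SUP f\<in>vanishing_ball X. f y) + sqrt (K x x - 2 * K x y + K y y)"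
      using vanishing_ball_bound(2)[OF f, of x y] cSUP_upper[OF f bdd_above_vanishing_ball, of y]
      by linarith
  qed
  from this[of x y] this[of y x] show ?thesis by (simp add: kernel_commute[of y x] algebra_simps)
qed

text \<open>Homogeneity carries the definition of the supremum over from the unit ball. This is how
  the power function comes to control a quadrature residual pointwise.\<close>

lemma vanishing_function_bound:
  assumes f: "f \<in> H" "\<And>y. y \<in> X \<Longrightarrow> f y = 0"
  shows "f x \<le> sqrt (ip f f) * (SUP f\<in>vanishing_ball X. f x)"
proof (cases "ip f f = 0")
  case True
  then show ?thesis using ip_definite[OF f(1)] by simp
next
  case False
  define n where "n = sqrt (ip f f)"
  have n: "n > 0" "n * n = ip f f" using False ip_nonneg[OF f(1)] by (auto simp: n_def)
  let ?g = "\<lambda>x. (1 / n) * f x"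
  have "ip ?g ?g = (1 / n) * ((1 / n) * ip f f)"
    by (subst ip_scale_left[OF f(1) scale_mem[OF f(1)]], subst ip_scale_right[OF f(1) f(1)]) simp
  also have "\<dots> = 1" using n by (simp flip: n(2))
  finally have "?g \<in> vanishing_ball X"
    using f scale_mem[OF f(1), of "1 / n"] by (auto simp: vanishing_ball_def)
  from cSUP_upper[OF this bdd_above_vanishing_ball, of x] show ?thesis
    using n(1) by (simp add: n_def[symmetric] field_simps)
qed

end

section \<open>Square-summable families\<close>

definition square_summable :: "('i \<Rightarrow> real) \<Rightarrow> bool" where
  "square_summable c \<longleftrightarrow> (\<lambda>i. (c i)\<^sup>2) summable_on UNIV"

lemma square_summable_prod:
  assumes "square_summable c" "square_summable d"
  shows "(\<lambda>i. c i * d i) summable_on UNIV"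
proof -
  have "(\<lambda>i. (c i)\<^sup>2 + (d i)\<^sup>2) summable_on UNIV"
    using assms by (auto simp: square_summable_def intro: summable_on_add)
  moreover have "norm (c i * d i) \<le> (c i)\<^sup>2 + (d i)\<^sup>2" for i
  proof -
    have "2 * (\<bar>c i\<bar> * \<bar>d i\<bar>) \<le> (c i)\<^sup>2 + (d i)\<^sup>2"
      using zero_le_power2[of "\<bar>c i\<bar> - \<bar>d i\<bar>"] by (simp add: power2_diff)
    moreover have "0 \<le> \<bar>c i\<bar> * \<bar>d i\<bar>" by simp
    ultimately show ?thesis by (simp only: real_norm_def abs_mult)
  qed
  ultimately have "(\<lambda>i. norm (c i * d i)) summable_on UNIV"
    by (rule Infinite_Sum.abs_summable_on_comparison_test')
  then show ?thesis by (rule abs_summable_summable)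
qed

lemma square_summable_zero: "square_summable (\<lambda>i. 0)"
  by (simp add: square_summable_def)

lemma square_summable_scale: "square_summable c \<Longrightarrow> square_summable (\<lambda>i. a * c i)"
  by (simp add: square_summable_def power_mult_distrib summable_on_cmult_right)

lemma square_summable_add:
  assumes "square_summable c" "square_summable d"
  shows "square_summable (\<lambda>i. c i + d i)"
proof -
  have "(\<lambda>i. (c i)\<^sup>2 + (d i)\<^sup>2 + 2 * (c i * d i)) summable_on UNIV"
    using assms square_summable_prod[OF assms]
    by (intro summable_on_add summable_on_cmult_right) (auto simp: square_summable_def)
  then show ?thesis by (simp add: square_summable_def power2_sum mult.assoc)
qed

lemma square_summable_diff:
  "square_summable c \<Longrightarrow> square_summable d \<Longrightarrow> square_summable (\<lambda>i. c i - d i)"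
  using square_summable_add[OF _ square_summable_scale, of c d "-1"] by simp

text \<open>The coordinatewise limit is the candidate. Bounds on finite partial sums survive the
  limit with the same N for every finite index set, which yields both summability and convergence in
  norm.\<close>

lemma square_summable_complete:
  fixes c :: "nat \<Rightarrow> 'i \<Rightarrow> real"
  assumes c: "\<And>n. square_summable (c n)"
    and Cauchy: "\<And>e. e > 0 \<Longrightarrow> \<exists>N. \<forall>m\<ge>N. \<forall>n\<ge>N. sqrt (\<Sum>\<^sub>\<infinity>i. (c m i - c n i)\<^sup>2) < e"
  obtains d where "square_summable d" "(\<lambda>n. sqrt (\<Sum>\<^sub>\<infinity>i. (c n i - d i)\<^sup>2)) \<longlonglongrightarrow> 0"
proof -
  have summ: "(\<lambda>i. (c m i - c n i)\<^sup>2) summable_on UNIV" for m n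
    using square_summable_diff[OF c c] by (simp add: square_summable_def)
  have partial: "(\<Sum>i\<in>F. (c m i - c n i)\<^sup>2) \<le> (\<Sum>\<^sub>\<infinity>i. (c m i - c n i)\<^sup>2)" if "finite F" for F m n
    using summ that by (intro finite_sum_le_infsum) auto
  have "\<exists>l. (\<lambda>n. c n i) \<longlonglongrightarrow> l" for i
  proof -
    have "Cauchy (\<lambda>n. c n i)"
    proof (rule CauchyI)
      fix e :: real assume "0 < e"
      then obtain N where N: "\<forall>m\<ge>N. \<forall>n\<ge>N. sqrt (\<Sum>\<^sub>\<infinity>i. (c m i - c n i)\<^sup>2) < e"
        using Cauchy by blast
      have "norm (c m i - c n i) < e" if "m \<ge> N" "n \<ge> N" for m n
      proof -
        have "norm (c m i - c n i) = sqrt ((c m i - c n i)\<^sup>2)" by simp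
        also have "\<dots> \<le> sqrt (\<Sum>\<^sub>\<infinity>i. (c m i - c n i)\<^sup>2)"
          using partial[of "{i}" m n] by (intro real_sqrt_le_mono) simp
        finally show ?thesis using N that by fastforce
      qed
      then show "\<exists>M. \<forall>m\<ge>M. \<forall>n\<ge>M. norm (c m i - c n i) < e" by blast
    qed
    then show ?thesis by (simp add: Cauchy_convergent convergentD)
  qed
  then obtain d where d: "\<And>i. (\<lambda>n. c n i) \<longlonglongrightarrow> d i" by metis
  have key: "\<exists>N. \<forall>n\<ge>N. (\<lambda>i. (c n i - d i)\<^sup>2) summable_on UNIV \<and> (\<Sum>\<^sub>\<infinity>i. (c n i - d i)\<^sup>2) \<le> e\<^sup>2"
    if e: "e > 0" for e :: real
  proof -
    obtain N where N: "\<forall>m\<ge>N. \<forall>n\<ge>N. sqrt (\<Sum>\<^sub>\<infinity>i. (c m i - c n i)\<^sup>2) < e"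
      using Cauchy[OF e] by blast
    have fin: "(\<Sum>i\<in>F. (c n i - d i)\<^sup>2) \<le> e\<^sup>2" if "finite F" "n \<ge> N" for F n
    proof -
      have lim: "(\<lambda>m. \<Sum>i\<in>F. (c n i - c m i)\<^sup>2) \<longlonglongrightarrow> (\<Sum>i\<in>F. (c n i - d i)\<^sup>2)"
        by (intro tendsto_intros d)
      have "(\<Sum>i\<in>F. (c n i - c m i)\<^sup>2) \<le> e\<^sup>2" if "m \<ge> N" for m
      proof -
        have "sqrt (\<Sum>\<^sub>\<infinity>i. (c n i - c m i)\<^sup>2) < e" using N that \<open>n \<ge> N\<close> by blast
        then have "(\<Sum>\<^sub>\<infinity>i. (c n i - c m i)\<^sup>2) < e\<^sup>2"
          using \<open>e > 0\<close> by (metis less_eq_real_def real_sqrt_less_iff real_sqrt_unique)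
        with partial[OF \<open>finite F\<close>, of n m] show ?thesis by linarith
      qed
      then show ?thesis using lim by (intro LIMSEQ_le_const2[OF lim]) blast
    qed
    have "(\<lambda>i. (c n i - d i)\<^sup>2) summable_on UNIV \<and> (\<Sum>\<^sub>\<infinity>i. (c n i - d i)\<^sup>2) \<le> e\<^sup>2" if "n \<ge> N" for n
    proof -
      have s: "(\<lambda>i. (c n i - d i)\<^sup>2) summable_on UNIV"
      proof (rule nonneg_bdd_above_summable_on)
        show "bdd_above (sum (\<lambda>i. (c n i - d i)\<^sup>2) ` {F. F \<subseteq> UNIV \<and> finite F})"
          using fin that by (intro bdd_aboveI2[where M="e\<^sup>2"]) auto
      qed simp
      with fin that show ?thesis by (auto intro: infsum_le_finite_sums)
    qed
    then show ?thesis by blast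
  qed
  obtain N where "(\<lambda>i. (c N i - d i)\<^sup>2) summable_on UNIV" using key[of 1] by auto
  then have "square_summable (\<lambda>i. c N i - d i)" by (simp add: square_summable_def)
  from square_summable_diff[OF c this, of N] have "square_summable d" by simp
  moreover have "(\<lambda>n. sqrt (\<Sum>\<^sub>\<infinity>i. (c n i - d i)\<^sup>2)) \<longlonglongrightarrow> 0"
  proof (rule LIMSEQ_I)
    fix e :: real assume "0 < e"
    then obtain N where N: "\<forall>n\<ge>N. (\<Sum>\<^sub>\<infinity>i. (c n i - d i)\<^sup>2) \<le> (e/2)\<^sup>2"
      using key[of "e/2"] by auto
    have "norm (sqrt (\<Sum>\<^sub>\<infinity>i. (c n i - d i)\<^sup>2) - 0) < e" if "n \<ge> N" for n
    proof -
      have "sqrt (\<Sum>\<^sub>\<infinity>i. (c n i - d i)\<^sup>2) \<le> sqrt ((e/2)\<^sup>2)"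
        using N that by (intro real_sqrt_le_mono) blast
      then have "sqrt (\<Sum>\<^sub>\<infinity>i. (c n i - d i)\<^sup>2) < e" using \<open>0 < e\<close> by simp
      moreover have "0 \<le> sqrt (\<Sum>\<^sub>\<infinity>i. (c n i - d i)\<^sup>2)" by (simp add: infsum_nonneg)
      ultimately show ?thesis by simp
    qed
    then show "\<exists>N. \<forall>n\<ge>N. norm (sqrt (\<Sum>\<^sub>\<infinity>i. (c n i - d i)\<^sup>2) - 0) < e" by blast
  qed
  ultimately show ?thesis by (rule that)
qed

text \<open>The space is the image of the square-summable sequences under the expansion in the
  features. Independence makes this map injective, so inner product and completeness can be
  transported, and evaluation at y becomes the inner product with the feature sequence of y.\<close>

theorem feature_expansion_rkhs:
  fixes \<phi> :: "'i \<Rightarrow> 'a \<Rightarrow> real"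
  assumes features: "\<And>x. square_summable (\<lambda>i. \<phi> i x)"
    and independent: "\<And>c. \<lbrakk>square_summable c; \<And>x. (\<Sum>\<^sub>\<infinity>i. c i * \<phi> i x) = 0\<rbrakk> \<Longrightarrow> c = (\<lambda>i. 0)"
    and expansion: "\<And>x y. K x y = (\<Sum>\<^sub>\<infinity>i. \<phi> i x * \<phi> i y)"
  shows "\<exists>H ip. reproducing_kernel_hilbert_space K H ip"
proof -
  define F where "F c = (\<lambda>x. \<Sum>\<^sub>\<infinity>i. c i * \<phi> i x)" for c
  define H where "H = F ` Collect square_summable"
  define coef where "coef f = (SOME c. square_summable c \<and> F c = f)" for f
  define ip where "ip f g = (\<Sum>\<^sub>\<infinity>i. coef f i * coef g i)" for f g
  have F_add: "F (\<lambda>i. c i + d i) = (\<lambda>x. F c x + F d x)"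
    if "square_summable c" "square_summable d" for c d
    unfolding F_def using that
    by (simp add: distrib_right infsum_add square_summable_prod features)
  have F_scale: "F (\<lambda>i. a * c i) = (\<lambda>x. a * F c x)" if "square_summable c" for a c
    unfolding F_def using that
    by (simp add: mult.assoc infsum_cmult_right square_summable_prod features)
  have F_diff: "F (\<lambda>i. c i - d i) = (\<lambda>x. F c x - F d x)"
    if "square_summable c" "square_summable d" for c d
    using F_add[OF that(1) square_summable_scale[OF that(2)], of "-1"] F_scale[OF that(2), of "-1"]
    by simp
  have F_inj: "c = d" if "square_summable c" "square_summable d" "F c = F d" for c d
  proof -
    have "F (\<lambda>i. c i - d i) x = 0" for x using F_diff[OF that(1,2)] that(3) by simp
    then have "(\<lambda>i. c i - d i) = (\<lambda>i. 0)"
      using square_summable_diff[OF that(1,2)] by (intro independent) (auto simp: F_def)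
    then show ?thesis by (auto simp: fun_eq_iff)
  qed
  have coef: "coef (F c) = c" if "square_summable c" for c
  proof -
    have "square_summable (coef (F c)) \<and> F (coef (F c)) = F c"
      unfolding coef_def using that by (intro someI[of "\<lambda>d. square_summable d \<and> F d = F c" c]) simp
    with F_inj that show ?thesis by blast
  qed
  have ip: "ip (F c) (F d) = (\<Sum>\<^sub>\<infinity>i. c i * d i)" if "square_summable c" "square_summable d" for c d
    using that by (simp add: ip_def coef)
  have HE: "\<exists>c. square_summable c \<and> f = F c" if "f \<in> H" for f
    using that by (auto simp: H_def)
  have HI: "F c \<in> H" if "square_summable c" for c
    using that by (auto simp: H_def)
  have kernel: "(\<lambda>x. K x y) = F (\<lambda>i. \<phi> i y)" for y
    by (simp add: F_def expansion mult.commute)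
  have "reproducing_kernel_hilbert_space K H ip"
  proof
    have "F (\<lambda>i. 0) = (\<lambda>x. 0)" by (simp add: F_def)
    then show "(\<lambda>x. 0) \<in> H" using HI[OF square_summable_zero] by simp
  next
    fix f g assume "f \<in> H" "g \<in> H"
    then obtain c d where "square_summable c" "f = F c" "square_summable d" "g = F d"
      using HE by blast
    then show "(\<lambda>x. f x + g x) \<in> H" "ip f g = ip g f"
      using F_add HI[OF square_summable_add] by (auto simp: ip mult.commute)
  next
    fix f a assume "f \<in> H"
    then obtain c where "square_summable c" "f = F c" using HE by blast
    then show "(\<lambda>x. a * f x) \<in> H"
      using F_scale[of c a] HI[OF square_summable_scale, of c a] by simp
  next
    fix f g h assume "f \<in> H" "g \<in> H" "h \<in> H"
    then obtain c d e where *: "square_summable c" "f = F c" "square_summable d" "g = F d"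
      "square_summable e" "h = F e"
      using HE by metis
    show "ip (\<lambda>x. f x + g x) h = ip f h + ip g h"
      unfolding * F_add[OF *(1,3), symmetric]
      by (simp add: ip * square_summable_add distrib_right infsum_add square_summable_prod)
  next
    fix f g a assume "f \<in> H" "g \<in> H"
    then obtain c d where *: "square_summable c" "f = F c" "square_summable d" "g = F d"
      using HE by blast
    show "ip (\<lambda>x. a * f x) g = a * ip f g"
      unfolding * F_scale[OF *(1), symmetric]
      by (simp add: ip * square_summable_scale mult.assoc infsum_cmult_right square_summable_prod)
  next
    fix f assume "f \<in> H"
    then obtain c where *: "square_summable c" "f = F c" using HE by blast
    then show "0 \<le> ip f f" by (simp add: ip infsum_nonneg)
    assume "ip f f = 0"
    then have "(\<Sum>\<^sub>\<infinity>i. (c i)\<^sup>2) \<le> 0" by (simp add: * ip power2_eq_square)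
    then have "(c i)\<^sup>2 = 0" for i
      by (rule nonneg_infsum_le_0D) (use *(1) in \<open>auto simp: square_summable_def\<close>)
    then have "c = (\<lambda>i. 0)" by auto
    then show "f = (\<lambda>x. 0)" by (simp add: *(2) F_def)
  next
    fix s assume s: "\<And>n::nat. s n \<in> H" and
      Cauchy: "\<forall>e>0. \<exists>N. \<forall>m\<ge>N. \<forall>n\<ge>N. sqrt (ip (\<lambda>x. s m x - s n x) (\<lambda>x. s m x - s n x)) < e"
    obtain c where c: "\<And>n. square_summable (c n)" "\<And>n. s n = F (c n)"
      using choice[of "\<lambda>n c. square_summable c \<and> s n = F c"] HE[OF s] by blast
    have dist: "ip (\<lambda>x. F c x - F d x) (\<lambda>x. F c x - F d x) = (\<Sum>\<^sub>\<infinity>i. (c i - d i)\<^sup>2)"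
      if "square_summable c" "square_summable d" for c d
      unfolding F_diff[OF that, symmetric]
      using that by (simp add: ip square_summable_diff power2_eq_square)
    have "\<exists>N. \<forall>m\<ge>N. \<forall>n\<ge>N. sqrt (\<Sum>\<^sub>\<infinity>i. (c m i - c n i)\<^sup>2) < e" if "e > 0" for e
      using Cauchy[rule_format, OF that] by (simp add: c dist)
    from square_summable_complete[OF c(1) this]
    obtain d where d: "square_summable d" "(\<lambda>n. sqrt (\<Sum>\<^sub>\<infinity>i. (c n i - d i)\<^sup>2)) \<longlonglongrightarrow> 0"
      by blast
    then show "\<exists>f\<in>H. (\<lambda>n. sqrt (ip (\<lambda>x. s n x - f x) (\<lambda>x. s n x - f x))) \<longlonglongrightarrow> 0"
      by (intro bexI[of _ "F d"] HI) (simp_all add: c dist)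
  next
    show "(\<lambda>x. K x y) \<in> H" for y unfolding kernel by (intro HI features)
    fix f y assume "f \<in> H"
    then obtain c where *: "square_summable c" "f = F c" using HE by blast
    show "ip f (\<lambda>x. K x y) = f y"
      unfolding kernel *(2) by (simp add: ip *(1) features) (simp add: F_def)
  qed
  then show ?thesis by blast
qed

section \<open>Uniqueness of multivariate power series\<close>

text \<open>A power series with a nonzero coefficient of positive index has isolated zeros, which
  the zero function violates; the constant coefficient is read off at z = 0.\<close>

lemma power_series_zero_coefficients:
  fixes b :: "nat \<Rightarrow> real"
  assumes "\<And>z. (\<lambda>m. b m * z ^ m) sums 0"
  shows "b m = 0"
proof (rule ccontr)
  assume "b m \<noteq> 0"
  have "b 0 = 0" using sums_unique2[OF assms[of 0] powser_sums_zero] by simp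
  with \<open>b m \<noteq> 0\<close> have "m > 0" by (cases m) auto
  show False
  proof (rule powser_0_nonzero[of 1 0 b "\<lambda>_. 0" m])
    show "(\<lambda>n. b n * (z - 0) ^ n) sums 0" for z using assms[of z] by simp
    fix s :: real assume "0 < s" and s: "\<And>z::real. z \<in> cball 0 s - {0} \<Longrightarrow> (0::real) \<noteq> 0"
    from \<open>0 < s\<close> s[of s] show False by simp
  qed (simp_all add: \<open>b m \<noteq> 0\<close> \<open>m > 0\<close>)
qed

text \<open>Induction on the variables: with those in S frozen, the series is a power series in
  \<open>t j\<close> alone, so its coefficients vanish; these are series over S, to which the
  induction hypothesis applies.\<close>

lemma multivariate_power_series_zero_coefficients:
  fixes a :: "('d \<Rightarrow> nat) \<Rightarrow> real"
  assumes "finite S"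
    and "\<And>t. (\<lambda>n. a n * (\<Prod>i\<in>S. t i ^ n i)) summable_on PiE S (\<lambda>_. UNIV)"
    and "\<And>t. (\<Sum>\<^sub>\<infinity>n\<in>PiE S (\<lambda>_. UNIV). a n * (\<Prod>i\<in>S. t i ^ n i)) = 0"
    and "n \<in> PiE S (\<lambda>_. UNIV)"
  shows "a n = 0"
  using assms
proof (induction S arbitrary: a n rule: finite_induct)
  case empty
  then show ?case by simp
next
  case (insert j S)
  let ?P = "PiE S (\<lambda>_. UNIV :: nat set)"
  let ?h = "\<lambda>(m, n). n(j := m)"
  have image: "PiE (insert j S) (\<lambda>_. UNIV) = ?h ` (UNIV \<times> ?P)"
    by (simp add: PiE_insert_eq)
  have inj: "inj_on ?h (UNIV \<times> ?P)"
    using inj_combinator[of j S "\<lambda>_. UNIV"] insert.hyps by simp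
  have monomial: "a (n(j := m)) * (\<Prod>i\<in>insert j S. t i ^ (n(j := m)) i) =
      t j ^ m * (a (n(j := m)) * (\<Prod>i\<in>S. t i ^ n i))" for m n and t :: "'d \<Rightarrow> real"
  proof -
    have "(\<Prod>i\<in>S. t i ^ (n(j := m)) i) = (\<Prod>i\<in>S. t i ^ n i)"
      using insert.hyps by (intro prod.cong) auto
    then show ?thesis using insert.hyps by simp
  qed
  have summ: "(\<lambda>(m, n). t j ^ m * (a (n(j := m)) * (\<Prod>i\<in>S. t i ^ n i))) summable_on UNIV \<times> ?P"
    for t :: "'d \<Rightarrow> real"
    using insert.prems(1)[of t] unfolding image summable_on_reindex[OF inj]
    by (simp only: o_def case_prod_unfold monomial)
  have zero: "(\<Sum>\<^sub>\<infinity>(m, n)\<in>UNIV \<times> ?P. t j ^ m * (a (n(j := m)) * (\<Prod>i\<in>S. t i ^ n i))) = 0"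
    for t :: "'d \<Rightarrow> real"
    using insert.prems(2)[of t] unfolding image infsum_reindex[OF inj]
    by (simp only: o_def case_prod_unfold monomial)
  define b where "b t m = (\<Sum>\<^sub>\<infinity>n\<in>?P. a (n(j := m)) * (\<Prod>i\<in>S. t i ^ n i))" for t m
  \<comment> \<open>The coefficients do not see variable j, so z can vary while they stay
    fixed.\<close>
  have b_upd: "b (t(j := z)) m = b t m" for t z m
  proof -
    have "(\<Prod>i\<in>S. (t(j := z)) i ^ n i) = (\<Prod>i\<in>S. t i ^ n i)" for n :: "'d \<Rightarrow> nat"
      using insert.hyps by (intro prod.cong) auto
    then show ?thesis by (simp add: b_def)
  qed
  have "(\<lambda>m. b t m * z ^ m) sums 0" for t z
  proof -
    let ?t = "t(j := z)"
    let ?f = "\<lambda>m n. ?t j ^ m * (a (n(j := m)) * (\<Prod>i\<in>S. ?t i ^ n i))"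
    have inner: "(\<Sum>\<^sub>\<infinity>n\<in>?P. ?f m n) = b t m * z ^ m" for m
      by (simp only: infsum_cmult_right' b_def[symmetric] b_upd) simp
    have "(\<lambda>m. b t m * z ^ m) summable_on UNIV"
      using summable_on_Sigma_banach[OF summ[of ?t]] unfolding inner .
    moreover have "(\<Sum>\<^sub>\<infinity>m. b t m * z ^ m) = 0"
      using infsum_Sigma'_banach[OF summ[of ?t]] zero[of ?t] unfolding inner by simp
    ultimately show ?thesis using has_sum_imp_sums has_sum_infsum by fastforce
  qed
  then have b0: "b t m = 0" for t m by (rule power_series_zero_coefficients)
  have slice: "(\<lambda>n. a (n(j := m)) * (\<Prod>i\<in>S. t i ^ n i)) summable_on ?P" for t m
  proof -
    \<comment> \<open>With the value 1 at j the factor \<open>t j ^ m\<close> disappears, and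
      restricting the full family to the fibre over m leaves the inner series.\<close>
    let ?t = "t(j := 1)"
    have "(\<lambda>(m, n). ?t j ^ m * (a (n(j := m)) * (\<Prod>i\<in>S. ?t i ^ n i))) summable_on (Pair m ` ?P)"
      by (rule summable_on_subset_banach[OF summ]) auto
    then have "(\<lambda>n. a (n(j := m)) * (\<Prod>i\<in>S. ?t i ^ n i)) summable_on ?P"
      by (subst (asm) summable_on_reindex) (auto simp: o_def inj_on_def)
    moreover have "(\<Prod>i\<in>S. ?t i ^ n i) = (\<Prod>i\<in>S. t i ^ n i)" for n :: "'d \<Rightarrow> nat"
      using insert.hyps by (intro prod.cong) auto
    ultimately show ?thesis by simp
  qed
  obtain m n' where n': "n = n'(j := m)" "n' \<in> ?P" using insert.prems(3) unfolding image by auto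
  have "a (n'(j := m)) = 0"
    using insert.IH[of "\<lambda>n. a (n(j := m))" n'] slice b0 n'(2) by (simp add: b_def)
  then show ?case by (simp only: n'(1))
qed

section \<open>Existence of the Gaussian reproducing kernel Hilbert space\<close>

definition gaussian_feature :: "nat \<Rightarrow> real \<Rightarrow> real" where
  "gaussian_feature m s = exp (- s\<^sup>2 / 2) * (s ^ m / sqrt (fact m))"

text \<open>Expanding the square in the exponent leaves exp (s t) as the only mixed factor; its
  Taylor series supplies the sum.\<close>

lemma gaussian_feature_expansion:
  "((\<lambda>m. gaussian_feature m s * gaussian_feature m t) has_sum exp (- (s - t)\<^sup>2 / 2)) UNIV"
proof -
  have "((\<lambda>m. (s * t) ^ m /\<^sub>R fact m) has_sum exp (s * t)) UNIV"
    by (intro norm_summable_imp_has_sum summable_norm_exp exp_converges)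
  then have "((\<lambda>m. exp (- s\<^sup>2 / 2) * exp (- t\<^sup>2 / 2) * ((s * t) ^ m /\<^sub>R fact m)) has_sum
      exp (- s\<^sup>2 / 2) * exp (- t\<^sup>2 / 2) * exp (s * t)) UNIV"
    by (rule has_sum_cmult_right)
  also have "(\<lambda>m. exp (- s\<^sup>2 / 2) * exp (- t\<^sup>2 / 2) * ((s * t) ^ m /\<^sub>R fact m)) =
      (\<lambda>m. gaussian_feature m s * gaussian_feature m t)"
  proof
    fix m
    have "sqrt (fact m) * sqrt (fact m) = (fact m :: real)" by simp
    then show "exp (- s\<^sup>2 / 2) * exp (- t\<^sup>2 / 2) * ((s * t) ^ m /\<^sub>R fact m) =
        gaussian_feature m s * gaussian_feature m t"
      by (simp add: gaussian_feature_def field_simps)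
  qed
  also have "exp (- s\<^sup>2 / 2) * exp (- t\<^sup>2 / 2) * exp (s * t) = exp (- (s - t)\<^sup>2 / 2)"
    by (simp add: power2_diff field_simps flip: exp_add)
  finally show ?thesis .
qed

text \<open>The map \<open>\<pi>\<close> reads off coordinates, so that one proof serves both the
  real line and vectors. Its surjectivity makes every coordinate tuple available when a power series
  is extracted to prove independence of the features.\<close>

lemma gaussian_rkhs_exists:
  fixes \<pi> :: "'a \<Rightarrow> 'd::finite \<Rightarrow> real"
  assumes surj: "\<And>t. \<exists>x. \<pi> x = t" and "l > 0"
  shows "\<exists>H ip. reproducing_kernel_hilbert_space
    (\<lambda>x y. \<Prod>i\<in>UNIV. exp (- (\<pi> x i - \<pi> y i)\<^sup>2 / (2 * l\<^sup>2))) H ip"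
proof -
  let ?K = "\<lambda>x y. \<Prod>i\<in>UNIV. exp (- (\<pi> x i - \<pi> y i)\<^sup>2 / (2 * l\<^sup>2))"
  define \<phi> :: "('d \<Rightarrow> nat) \<Rightarrow> 'a \<Rightarrow> real"
    where "\<phi> n x = (\<Prod>i\<in>UNIV. gaussian_feature (n i) (\<pi> x i / l))" for n x
  have UNIV_eq: "PiE (UNIV :: 'd set) (\<lambda>_. UNIV :: nat set) = UNIV"
    by (simp add: PiE_UNIV_domain)
  have expansion: "(\<Sum>\<^sub>\<infinity>n. \<phi> n x * \<phi> n y) = ?K x y" for x y
  proof -
    let ?f = "\<lambda>i m. gaussian_feature m (\<pi> x i / l) * gaussian_feature m (\<pi> y i / l)"
    have "(\<Sum>\<^sub>\<infinity>n. \<phi> n x * \<phi> n y) = (\<Sum>\<^sub>\<infinity>n\<in>PiE UNIV (\<lambda>_. UNIV). \<Prod>i\<in>UNIV. ?f i (n i))"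
      by (simp only: UNIV_eq \<phi>_def prod.distrib)
    also have "\<dots> = (\<Prod>i\<in>UNIV. \<Sum>\<^sub>\<infinity>m. ?f i m)"
    proof (rule infsum_prod_PiE_abs)
      show "(\<lambda>m. norm (?f i m)) summable_on UNIV" for i
        by (rule iffD1[OF summable_on_iff_abs_summable_on_real
              has_sum_imp_summable[OF gaussian_feature_expansion]])
    qed simp
    also have "\<dots> = ?K x y"
    proof (rule prod.cong)
      fix i
      have "(\<Sum>\<^sub>\<infinity>m. ?f i m) = exp (- (\<pi> x i / l - \<pi> y i / l)\<^sup>2 / 2)"
        by (rule infsumI[OF gaussian_feature_expansion])
      also have "(\<pi> x i / l - \<pi> y i / l)\<^sup>2 = (\<pi> x i - \<pi> y i)\<^sup>2 / l\<^sup>2"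
        by (simp add: power_divide flip: diff_divide_distrib)
      finally show "(\<Sum>\<^sub>\<infinity>m. ?f i m) = exp (- (\<pi> x i - \<pi> y i)\<^sup>2 / (2 * l\<^sup>2))"
        by (simp add: mult.commute)
    qed simp
    finally show ?thesis .
  qed
  \<comment> \<open>A divergent sum has the default value 0, whereas the expansion gives the
    diagonal value K x x = 1.\<close>
  have features: "square_summable (\<lambda>n. \<phi> n x)" for x
  proof (rule ccontr)
    assume "\<not> square_summable (\<lambda>n. \<phi> n x)"
    then have "(\<Sum>\<^sub>\<infinity>n. \<phi> n x * \<phi> n x) = 0"
      by (intro infsum_not_exists) (simp add: square_summable_def power2_eq_square)
    then show False by (simp add: expansion)
  qed
  have independent: "c = (\<lambda>n. 0)"
    if c: "square_summable c" "\<And>x. (\<Sum>\<^sub>\<infinity>n. c n * \<phi> n x) = 0" for c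
  proof
    fix n
    define q :: "('d \<Rightarrow> nat) \<Rightarrow> real" where "q n = (\<Prod>i\<in>UNIV. sqrt (fact (n i)))" for n
    have q_pos: "q n > 0" for n unfolding q_def by (intro prod_pos) simp
    have series: "(\<lambda>n. c n / q n * (\<Prod>i\<in>UNIV. t i ^ n i)) summable_on UNIV \<and>
        (\<Sum>\<^sub>\<infinity>n. c n / q n * (\<Prod>i\<in>UNIV. t i ^ n i)) = 0" for t :: "'d \<Rightarrow> real"
    proof -
      \<comment> \<open>At the point with coordinates \<open>l * t i\<close> the features become
        monomials in t, up to the common nonzero factor \<open>G\<close> and the normalisation
        \<open>q n\<close>.\<close>
      define G where "G = (\<Prod>i\<in>UNIV. exp (- (t i)\<^sup>2 / 2))"
      have G: "G \<noteq> 0" by (simp add: G_def)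
      obtain x where x: "\<pi> x = (\<lambda>i. l * t i)" using surj by blast
      have "c n * \<phi> n x = G * (c n / q n * (\<Prod>i\<in>UNIV. t i ^ n i))" for n
        using \<open>l > 0\<close>
        by (simp add: \<phi>_def x gaussian_feature_def prod.distrib prod_dividef G_def q_def)
      then have "(\<lambda>n. G * (c n / q n * (\<Prod>i\<in>UNIV. t i ^ n i))) summable_on UNIV"
        "(\<Sum>\<^sub>\<infinity>n. G * (c n / q n * (\<Prod>i\<in>UNIV. t i ^ n i))) = 0"
        using square_summable_prod[OF c(1) features, of x] c(2)[of x] by simp_all
      then show ?thesis
        using G by (simp only: summable_on_cmult_right'[OF G] infsum_cmult_right') simp
    qed
    have "c n / q n = 0"
      by (rule multivariate_power_series_zero_coefficients[of UNIV "\<lambda>n. c n / q n"])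
        (use series in \<open>auto simp: UNIV_eq\<close>)
    then show "c n = 0" using q_pos[of n] by simp
  qed
  show ?thesis
    by (rule feature_expansion_rkhs[where \<phi>=\<phi>]) (use features independent expansion in auto)
qed

section \<open>Mean embeddings\<close>

text \<open>Lebesgue measure on vectors is the image of a product measure indexed by the basis, and
  the axis vectors enumerate that basis by coordinates; the rest is Fubini for products.\<close>

lemma lborel_integral_prod_vec:
  fixes g :: "'d::finite \<Rightarrow> real \<Rightarrow> real"
  assumes g: "\<And>i. integrable lborel (g i)"
  shows "integrable lborel (\<lambda>x::real^'d. \<Prod>i\<in>UNIV. g i (x $ i))"
    and "(LINT x|lborel. (\<Prod>i\<in>UNIV. g i ((x::real^'d) $ i))) = (\<Prod>i\<in>UNIV. LINT t|lborel. g i t)"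
proof -
  interpret product_sigma_finite "\<lambda>_::real^'d. lborel :: real measure" ..
  let ?ax = "\<lambda>i::'d. axis i (1::real)"
  let ?M = "\<Pi>\<^sub>M b\<in>(Basis :: (real^'d) set). (lborel :: real measure)"
  let ?T = "\<lambda>f. \<Sum>b\<in>Basis. f b *\<^sub>R (b :: real^'d)"
  define h where "h b = g (inv ?ax b)" for b
  have inj: "inj ?ax" by (auto simp: inj_on_def axis_eq_axis)
  have Basis: "(Basis :: (real^'d) set) = range ?ax" by (auto simp: Basis_vec_def)
  have coord: "?T f $ i = f (?ax i)" for f i
  proof -
    have "?T f $ i = (\<Sum>b\<in>Basis. f b * (b \<bullet> ?ax i))"
      by (simp add: inner_axis sum_component)
    also have "\<dots> = (\<Sum>b\<in>Basis. if b = ?ax i then f b else 0)"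
      by (intro sum.cong) (auto simp: inner_Basis Basis)
    finally show ?thesis by (simp add: Basis)
  qed
  have h: "integrable lborel (h b)" for b by (simp add: h_def g)
  have meas_g: "g i \<in> borel_measurable borel" for i
    using borel_measurable_integrable[OF g[of i]] by simp
  have meas: "(\<lambda>x::real^'d. \<Prod>i\<in>UNIV. g i (x $ i)) \<in> borel_measurable borel"
    by (intro borel_measurable_prod measurable_compose[OF _ meas_g]) simp
  have T: "?T \<in> measurable ?M borel" by simp
  have prod: "(\<Prod>i\<in>UNIV. g i (?T f $ i)) = (\<Prod>b\<in>Basis. h b (f b))" for f
    unfolding coord unfolding Basis prod.reindex[OF inj] h_def by (simp add: inv_f_f[OF inj])
  have "integrable ?M (\<lambda>f. \<Prod>b\<in>Basis. h b (f b))"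
    by (intro product_integrable_prod h) simp
  then show "integrable lborel (\<lambda>x::real^'d. \<Prod>i\<in>UNIV. g i (x $ i))"
    using T meas by (simp only: lborel_eq[where 'a="real^'d"] integrable_distr_eq prod)
  have "(LINT x|lborel. (\<Prod>i\<in>UNIV. g i ((x::real^'d) $ i))) = integral\<^sup>L ?M (\<lambda>f. \<Prod>b\<in>Basis. h b (f b))"
    using T meas by (simp only: lborel_eq[where 'a="real^'d"] integral_distr prod)
  also have "\<dots> = (\<Prod>b\<in>Basis. LINT t|lborel. h b t)"
    by (intro product_integral_prod h) simp
  also have "\<dots> = (\<Prod>i\<in>UNIV. LINT t|lborel. g i t)"
    unfolding Basis prod.reindex[OF inj] h_def by (simp add: inv_f_f[OF inj])
  finally show "(LINT x|lborel. (\<Prod>i\<in>UNIV. g i ((x::real^'d) $ i))) = (\<Prod>i\<in>UNIV. LINT t|lborel. g i t)" .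
qed

text \<open>The bound is a multiple of the distance between kernel functions, which tends to 0 as y
  approaches x. Leaving \<open>h\<close> arbitrary covers both members of the space and the power
  function.\<close>

lemma isCont_if_kernel_modulus:
  fixes K :: "'a::t2_space \<Rightarrow> 'a \<Rightarrow> real"
  assumes mod: "\<And>x y. \<bar>h x - h y\<bar> \<le> B * sqrt (K x x - 2 * K x y + K y y)"
    and one: "\<And>x. K x x = 1" and cont: "isCont (\<lambda>y. K y x) x"
  shows "isCont h x"
proof -
  have "((\<lambda>y. h y - h x) \<longlongrightarrow> 0) (at x)"
  proof (rule Lim_null_comparison)
    show "\<forall>\<^sub>F y in at x. norm (h y - h x) \<le> B * sqrt (2 - 2 * K y x)"
      using mod one by (intro always_eventually) (metis diff_add_eq one_add_one real_norm_def)
    have "((\<lambda>y. B * sqrt (2 - 2 * K y x)) \<longlongrightarrow> B * sqrt (2 - 2 * K x x)) (at x)"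
      using cont by (intro tendsto_intros) (simp add: isCont_def)
    then show "((\<lambda>y. B * sqrt (2 - 2 * K y x)) \<longlongrightarrow> 0) (at x)" by (simp add: one)
  qed
  then show ?thesis by (simp add: isCont_def LIM_zero_cancel)
qed

text \<open>As K x x = 1, every f in \<open>H\<close> is bounded by its norm, so integration against
  a probability density is a functional of norm at most 1 and has a Riesz representer. Measurability
  of f follows from its continuity.\<close>

lemma mean_embedding:
  fixes K :: "'a::euclidean_space \<Rightarrow> 'a \<Rightarrow> real"
  assumes "reproducing_kernel_hilbert_space K H ip"
    and one: "\<And>x. K x x = 1" and cont: "\<And>x. isCont (\<lambda>y. K y x) x"
    and \<rho>: "integrable lborel \<rho>" "\<And>x. 0 \<le> \<rho> x" "(LINT x|lborel. \<rho> x) = 1"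
  shows "f \<in> H \<Longrightarrow> integrable lborel (\<lambda>x. f x * \<rho> x)"
    and "f \<in> H \<Longrightarrow> \<bar>LINT x|lborel. f x * \<rho> x\<bar> \<le> sqrt (ip f f)"
    and "\<exists>r\<in>H. \<forall>f\<in>H. (LINT x|lborel. f x * \<rho> x) = ip f r"
proof -
  interpret reproducing_kernel_hilbert_space K H ip by fact
  have int: "integrable lborel (\<lambda>x. f x * \<rho> x)"
    and bound: "\<bar>LINT x|lborel. f x * \<rho> x\<bar> \<le> sqrt (ip f f)" if "f \<in> H" for f
  proof -
    have "isCont f x" for x
      by (rule isCont_if_kernel_modulus[where K=K and B="sqrt (ip f f)"])
        (use pointwise_diff_bound[OF that] one cont in auto)
    then have [measurable]: "f \<in> borel_measurable borel"
      by (intro borel_measurable_continuous_onI continuous_at_imp_continuous_on) auto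
    have [measurable]: "\<rho> \<in> borel_measurable borel" using \<rho>(1) by auto
    have b: "\<bar>f x\<bar> \<le> sqrt (ip f f)" for x using pointwise_bound[OF that, of x] one by simp
    have n0: "0 \<le> sqrt (ip f f)" using ip_nonneg[OF that] by simp
    have b': "\<bar>f x * \<rho> x\<bar> \<le> sqrt (ip f f) * \<rho> x" for x
      using b[of x] \<rho>(2)[of x] by (simp add: abs_mult mult_right_mono)
    have int': "integrable lborel (\<lambda>x. sqrt (ip f f) * \<rho> x)" using \<rho>(1) by simp
    show int: "integrable lborel (\<lambda>x. f x * \<rho> x)"
      by (rule Bochner_Integration.integrable_bound[OF int'])
        (use b' n0 \<rho>(2) in \<open>auto simp: abs_mult\<close>)
    have "\<bar>LINT x|lborel. f x * \<rho> x\<bar> \<le> (LINT x|lborel. \<bar>f x * \<rho> x\<bar>)"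
      by (rule integral_abs_bound)
    also have "\<dots> \<le> (LINT x|lborel. sqrt (ip f f) * \<rho> x)"
      using int int' b' by (intro integral_mono) auto
    also have "\<dots> = sqrt (ip f f)" using \<rho>(3) by simp
    finally show "\<bar>LINT x|lborel. f x * \<rho> x\<bar> \<le> sqrt (ip f f)" .
  qed
  show "integrable lborel (\<lambda>x. f x * \<rho> x)" if "f \<in> H" by (rule int[OF that])
  show "\<bar>LINT x|lborel. f x * \<rho> x\<bar> \<le> sqrt (ip f f)" if "f \<in> H" by (rule bound[OF that])
  obtain r where "r \<in> H" "\<And>f. f \<in> H \<Longrightarrow> (LINT x|lborel. f x * \<rho> x) = ip f r"
  proof (rule Riesz_representation[of "\<lambda>f. LINT x|lborel. f x * \<rho> x" 1])
    fix f g assume "f \<in> H" "g \<in> H"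
    then show "(LINT x|lborel. (f x + g x) * \<rho> x) =
        (LINT x|lborel. f x * \<rho> x) + (LINT x|lborel. g x * \<rho> x)"
      by (simp add: distrib_right int)
  next
    fix f c assume "f \<in> H"
    then show "(LINT x|lborel. (c * f x) * \<rho> x) = c * (LINT x|lborel. f x * \<rho> x)"
      by (simp add: mult.assoc)
  next
    fix f assume f: "f \<in> H"
    have "(LINT x|lborel. f x * \<rho> x)\<^sup>2 \<le> (sqrt (ip f f))\<^sup>2"
      using bound[OF f] ip_nonneg[OF f] by (subst abs_le_square_iff[symmetric]) simp
    then show "(LINT x|lborel. f x * \<rho> x)\<^sup>2 \<le> 1 * ip f f" using ip_nonneg[OF f] by simp
  qed auto
  then show "\<exists>r\<in>H. \<forall>f\<in>H. (LINT x|lborel. f x * \<rho> x) = ip f r" by blast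
qed

section \<open>Gaussian kernels and densities\<close>

text \<open>Hilbert choice returns a genuine space only once existence is known; later facts about
  \<open>rkhs\<close> rest on this.\<close>

lemma rkhs_choice:
  assumes "\<exists>H ip. reproducing_kernel_hilbert_space K H ip"
  shows "reproducing_kernel_hilbert_space K (rkhs_space K) (snd (rkhs K))"
proof -
  have "\<exists>R. reproducing_kernel_hilbert_space K (fst R) (snd R)" using assms by auto
  then show ?thesis unfolding rkhs_space_def rkhs_def by (rule someI_ex)
qed

lemma gauss_kernel1_rkhs:
  assumes "l > 0"
  shows "reproducing_kernel_hilbert_space (gauss_kernel1 l)
    (rkhs_space (gauss_kernel1 l)) (snd (rkhs (gauss_kernel1 l)))"
proof (rule rkhs_choice)
  \<comment> \<open>The one-dimensional kernel is a product over a one-element index type.\<close>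
  have "\<exists>x. (\<lambda>_. x) = t" for t :: "unit \<Rightarrow> real"
    by (intro exI[of _ "t ()"]) (simp add: fun_eq_iff)
  from gaussian_rkhs_exists[of "\<lambda>x (_::unit). x :: real", OF this assms]
  show "\<exists>H ip. reproducing_kernel_hilbert_space (gauss_kernel1 l) H ip"
    by (simp add: UNIV_unit gauss_kernel1_def[abs_def])
qed

lemma gauss_kernel_prod: "gauss_kernel (\<chi> i. l) x y = (\<Prod>i\<in>UNIV. gauss_kernel1 l (x $ i) (y $ i))"
  by (simp add: gauss_kernel_def gauss_kernel1_def)

lemma gauss_kernel_rkhs:
  fixes l :: real
  assumes "l > 0"
  defines "K \<equiv> (gauss_kernel (\<chi> i. l) :: real ^ 'd \<Rightarrow> real ^ 'd \<Rightarrow> real)"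
  shows "reproducing_kernel_hilbert_space K (rkhs_space K) (snd (rkhs K))"
proof (rule rkhs_choice)
  have "\<exists>x. ($) x = t" for t :: "'d \<Rightarrow> real"
    by (intro exI[of _ "vec_lambda t"]) (simp add: fun_eq_iff)
  from gaussian_rkhs_exists[of "($) :: real ^ 'd \<Rightarrow> 'd \<Rightarrow> real", OF this assms(1)]
  show "\<exists>H ip. reproducing_kernel_hilbert_space K H ip"
    by (simp add: K_def gauss_kernel_def[abs_def])
qed

lemma gauss_kernel1_self [simp]: "gauss_kernel1 l x x = 1"
  by (simp add: gauss_kernel1_def)

lemma continuous_gauss_kernel1: "isCont (\<lambda>y. gauss_kernel1 l y x) z"
  unfolding gauss_kernel1_def divide_inverse by (intro continuous_intros)

lemma continuous_gauss_kernel: "isCont (\<lambda>y. gauss_kernel (\<chi> i. l) y x) z"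
  unfolding gauss_kernel_prod gauss_kernel1_def divide_inverse by (intro continuous_intros)

definition gauss_density :: "real \<Rightarrow> real \<Rightarrow> real" where
  "gauss_density \<alpha> x = 1 / (sqrt (2 * pi) * \<alpha>) * exp (- x\<^sup>2 / (2 * \<alpha>\<^sup>2))"

lemma gauss_density_eq_normal_density: "\<alpha> > 0 \<Longrightarrow> gauss_density \<alpha> = normal_density 0 \<alpha>"
  by (simp add: fun_eq_iff gauss_density_def normal_density_def real_sqrt_mult)

lemma gauss_density_probability:
  assumes "\<alpha> > 0"
  shows "integrable lborel (gauss_density \<alpha>)" "(LINT x|lborel. gauss_density \<alpha> x) = 1"
    "0 \<le> gauss_density \<alpha> x"
  using assms by (simp_all add: gauss_density_eq_normal_density)

lemma gauss_integral_eq: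
  "gauss_integral (\<chi> i. \<alpha>) f = (LINT x|lborel. f x * (\<Prod>i\<in>UNIV. gauss_density \<alpha> (x $ i)))"
  by (simp add: gauss_integral_def gauss_density_def)

section \<open>Reduction to the one-dimensional power function\<close>

lemma power_function_eq:
  assumes "l > 0"
  shows "power_function l X x = (SUP f\<in>reproducing_kernel_hilbert_space.vanishing_ball
    (rkhs_space (gauss_kernel1 l)) (snd (rkhs (gauss_kernel1 l))) X. f x)"
proof -
  interpret reproducing_kernel_hilbert_space "gauss_kernel1 l" "rkhs_space (gauss_kernel1 l)"
    "snd (rkhs (gauss_kernel1 l))"
    by (rule gauss_kernel1_rkhs[OF assms])
  show ?thesis by (simp add: power_function_def vanishing_ball_def rkhs_norm_def)
qed

lemma power_function_bounds_measurable:
  assumes "l > 0"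
  shows "0 \<le> power_function l X x" "power_function l X x \<le> 1"
    "power_function l X \<in> borel_measurable borel"
proof -
  interpret reproducing_kernel_hilbert_space "gauss_kernel1 l" "rkhs_space (gauss_kernel1 l)"
    "snd (rkhs (gauss_kernel1 l))"
    by (rule gauss_kernel1_rkhs[OF assms])
  show "0 \<le> power_function l X x" "power_function l X x \<le> 1"
    using SUP_vanishing_ball_bounds[where X=X and x=x] by (simp_all add: power_function_eq[OF assms])
  have "isCont (power_function l X) x" for x
    by (rule isCont_if_kernel_modulus[where K="gauss_kernel1 l" and B=1])
      (use SUP_vanishing_ball_diff[where X=X] continuous_gauss_kernel1
        in \<open>auto simp: power_function_eq[OF assms]\<close>)
  then show "power_function l X \<in> borel_measurable borel"
    by (intro borel_measurable_continuous_onI continuous_at_imp_continuous_on) auto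
qed

lemma integrable_power_function_gauss:
  assumes "\<alpha> > 0" "l > 0"
  shows "integrable lborel (\<lambda>x. power_function l X x * gauss_density \<alpha> x)"
proof (rule Bochner_Integration.integrable_bound[OF gauss_density_probability(1)[OF assms(1)]])
  note [measurable] = power_function_bounds_measurable(3)[OF assms(2)]
    borel_measurable_integrable[OF gauss_density_probability(1)[OF assms(1)]]
  show "(\<lambda>x. power_function l X x * gauss_density \<alpha> x) \<in> borel_measurable lborel" by measurable
  show "AE x in lborel. norm (power_function l X x * gauss_density \<alpha> x) \<le> norm (gauss_density \<alpha> x)"
    using power_function_bounds_measurable(1,2)[OF assms(2)] gauss_density_probability(3)[OF assms(1)]
    by (intro always_eventually) (auto simp: abs_mult intro: mult_left_le_one_le)
qed

text \<open>The conclusions use only integrals and sums, so that they can be multiplied over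
  coordinates. The integral of \<open>m\<close> is the squared norm of the mean embedding, the
  weighted sum that of its projection, and their difference that of the residual.\<close>

lemma gauss_quadrature_1d:
  assumes "\<alpha> > 0" "l > 0" "finite X"
  obtains m w where
    "\<forall>x. integrable lborel (\<lambda>t. gauss_kernel1 l t x * gauss_density \<alpha> t)"
    "\<forall>x. m x = (LINT t|lborel. gauss_kernel1 l t x * gauss_density \<alpha> t)"
    "integrable lborel (\<lambda>x. m x * gauss_density \<alpha> x)"
    "(\<Sum>x\<in>X. \<Sum>y\<in>X. w x * w y * gauss_kernel1 l x y) = (\<Sum>x\<in>X. w x * m x)"
    "0 \<le> (\<Sum>x\<in>X. w x * m x)"
    "(\<Sum>x\<in>X. w x * m x) \<le> (LINT x|lborel. m x * gauss_density \<alpha> x)"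
    "(LINT x|lborel. m x * gauss_density \<alpha> x) \<le> 1"
    "sqrt ((LINT x|lborel. m x * gauss_density \<alpha> x) - (\<Sum>x\<in>X. w x * m x))
      \<le> (LINT x|lborel. power_function l X x * gauss_density \<alpha> x)"
proof -
  let ?K = "gauss_kernel1 l"
  let ?H = "rkhs_space ?K"
  define ip where "ip = snd (rkhs ?K)"
  interpret reproducing_kernel_hilbert_space ?K ?H ip
    unfolding ip_def by (rule gauss_kernel1_rkhs[OF assms(2)])
  let ?I = "\<lambda>f. LINT x|lborel. f x * gauss_density \<alpha> x"
  note embedding = mean_embedding[OF reproducing_kernel_hilbert_space_axioms gauss_kernel1_self
      continuous_gauss_kernel1 gauss_density_probability(1,3,2)[OF assms(1)]]
  obtain m where m: "m \<in> ?H" "\<And>f. f \<in> ?H \<Longrightarrow> ?I f = ip f m" using embedding(3) by blast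
  obtain w where w: "\<And>y. y \<in> X \<Longrightarrow> kernel_residual m X w y = 0"
    using orthogonal_weights[OF m(1) assms(3)] by metis
  define R where "R = kernel_residual m X w"
  have R: "R \<in> ?H" unfolding R_def by (rule kernel_residual_mem[OF m(1)])
  have m_eq: "m x = (LINT t|lborel. ?K t x * gauss_density \<alpha> t)" for x
    using m(2)[OF kernel_mem, of x] ip_commute[OF kernel_mem m(1)] reproducing[OF m(1)] by simp
  define a where "a = ?I m"
  define b where "b = (\<Sum>x\<in>X. w x * m x)"
  have a: "a = ip m m" using m by (simp add: a_def)
  \<comment> \<open>The interpolation conditions turn the inner sum of the Gram form into
    \<open>m x\<close>.\<close>
  have c: "(\<Sum>x\<in>X. \<Sum>y\<in>X. w x * w y * ?K x y) = b"
  proof -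
    have "(\<Sum>y\<in>X. w x * w y * ?K x y) = w x * m x" if "x \<in> X" for x
      using w[OF that] by (simp add: sum_distrib_left mult.assoc)
    then show ?thesis by (simp add: b_def)
  qed
  have RR: "ip R R = a - b"
    using ip_kernel_residual[OF m(1), where X=X and w=w] c by (simp add: R_def a b_def)
  have b0: "0 \<le> b"
  proof -
    let ?p = "\<lambda>y. \<Sum>x\<in>X. w x * ?K y x"
    have p: "?p \<in> ?H" by (intro sum_mem kernel_mem)
    have "0 \<le> ip ?p ?p" by (rule ip_nonneg[OF p])
    also have "\<dots> = (\<Sum>x\<in>X. \<Sum>y\<in>X. w x * w y * ?K x y)"
      by (simp add: ip_kernel_comb[OF p] sum_distrib_left mult.assoc)
    finally show ?thesis by (simp add: c)
  qed
  have ba: "b \<le> a" using ip_nonneg[OF R] RR by simp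
  \<comment> \<open>\<open>a\<close> is at once the integral and the squared norm of
    \<open>m\<close>, so the norm bound on integration reads a \<le> sqrt a.\<close>
  have a1: "a \<le> 1"
  proof (rule ccontr)
    assume "\<not> a \<le> 1"
    then have "sqrt a < sqrt (a\<^sup>2)" by (intro real_sqrt_less_mono) (simp add: power2_eq_square)
    then have "sqrt a < a" using \<open>\<not> a \<le> 1\<close> by simp
    moreover have "a \<le> sqrt a" using embedding(2)[OF m(1)] by (simp add: a_def[symmetric] a[symmetric])
    ultimately show False by simp
  qed
  let ?P = "\<lambda>x. power_function l X x * gauss_density \<alpha> x"
  have P: "integrable lborel ?P" by (rule integrable_power_function_gauss[OF assms(1,2)])
  have "sqrt (a - b) \<le> integral\<^sup>L lborel ?P"
  proof (cases "a - b = 0")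
    case True
    then show ?thesis
      using power_function_bounds_measurable(1)[OF assms(2)] gauss_density_probability(3)[OF assms(1)] by (simp add: integral_nonneg)
  next
    case False
    with ba have pos: "0 < sqrt (a - b)" by simp
    have "R x * gauss_density \<alpha> x \<le> sqrt (a - b) * ?P x" for x
    proof -
      have "R x \<le> sqrt (ip R R) * power_function l X x"
        using vanishing_function_bound[OF R, where X=X and x=x] w
        by (simp add: R_def power_function_eq[OF assms(2)] ip_def)
      from mult_right_mono[OF this gauss_density_probability(3)[OF assms(1)], of x] show ?thesis
        by (simp add: RR mult.assoc)
    qed
    then have le: "?I R \<le> (LINT x|lborel. sqrt (a - b) * ?P x)"
      using embedding(1)[OF R] P by (intro integral_mono) auto
    \<comment> \<open>The residual vanishes at the nodes and is thus orthogonal to the projection,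
      so its squared norm equals its own integral; one factor sqrt (a - b) then cancels.\<close>
    have "ip R R = ip R m - (\<Sum>x\<in>X. w x * R x)"
      by (subst (2) R_def) (simp add: ip_diff_right m(1) sum_mem kernel_mem R ip_kernel_comb)
    also have "(\<Sum>x\<in>X. w x * R x) = 0" using w by (simp add: R_def)
    finally have "ip R R = ip R m" by simp
    then have "sqrt (a - b) * sqrt (a - b) = ?I R" using m(2)[OF R] RR ba by simp
    also note le
    also have "(LINT x|lborel. sqrt (a - b) * ?P x) = sqrt (a - b) * (LINT x|lborel. ?P x)" by simp
    finally show ?thesis using pos by (rule mult_left_le_imp_le)
  qed
  note err = this
  show ?thesis
  proof (rule that[of m w])
    show "\<forall>x. integrable lborel (\<lambda>t. ?K t x * gauss_density \<alpha> t)"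
      using embedding(1)[OF kernel_mem] by blast
    show "\<forall>x. m x = (LINT t|lborel. ?K t x * gauss_density \<alpha> t)"
      using m_eq by blast
  qed (fact embedding(1)[OF m(1)] c[unfolded b_def] b0[unfolded b_def] ba[unfolded a_def b_def]
      a1[unfolded a_def] err[unfolded a_def b_def])+
qed

section \<open>Tensor-product grids and the d-dimensional error\<close>

lemma sum_grid_prod:
  fixes g :: "'d::finite \<Rightarrow> real \<Rightarrow> real"
  assumes "finite X"
  shows "(\<Sum>x\<in>grid X. \<Prod>i\<in>UNIV. g i ((x :: real ^ 'd) $ i)) = (\<Prod>i\<in>UNIV. \<Sum>t\<in>X. g i t)"
proof -
  have "(\<Prod>i\<in>UNIV. \<Sum>t\<in>X. g i t) = (\<Sum>h\<in>PiE UNIV (\<lambda>_. X). \<Prod>i\<in>UNIV. g i (h i))"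
    using assms by (intro prod_sum_PiE) auto
  also have "\<dots> = (\<Sum>x\<in>grid X. \<Prod>i\<in>UNIV. g i ((x :: real ^ 'd) $ i))"
    by (rule sum.reindex_bij_witness[of _ "\<lambda>x i. x $ i" vec_lambda])
      (auto simp: grid_def PiE_UNIV_domain)
  finally show ?thesis by simp
qed

lemma finite_grid:
  assumes "finite X"
  shows "finite (grid X :: (real ^ 'd) set)"
proof -
  have "grid X \<subseteq> vec_lambda ` (PiE (UNIV :: 'd set) (\<lambda>_. X))"
  proof
    fix x :: "real ^ 'd" assume "x \<in> grid X"
    then have "x = vec_lambda (\<lambda>i. x $ i)" "(\<lambda>i. x $ i) \<in> PiE UNIV (\<lambda>_. X)"
      by (auto simp: grid_def)
    then show "x \<in> vec_lambda ` (PiE (UNIV :: 'd set) (\<lambda>_. X))" by (rule image_eqI)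
  qed
  then show ?thesis by (rule finite_subset) (intro finite_imageI finite_PiE; simp add: assms)
qed

text \<open>Telescoping with a * (a ^ n - b ^ n) + b ^ n * (a - b), where the factors a and b ^ n
  are at most 1.\<close>

lemma power_diff_le:
  fixes a b :: real
  assumes "0 \<le> b" "b \<le> a" "a \<le> 1"
  shows "a ^ n - b ^ n \<le> real n * (a - b)"
proof (induction n)
  case (Suc n)
  have "a * (a ^ n - b ^ n) \<le> 1 * (real n * (a - b))"
    using assms Suc power_mono[of b a n] by (intro mult_mono) auto
  moreover have "b ^ n * (a - b) \<le> 1 * (a - b)"
    using assms by (intro mult_right_mono power_le_one) auto
  ultimately show ?case by (simp add: algebra_simps)
qed simp

lemma worst_case_error_opt_rule_le:
  assumes "\<alpha> > 0" "l > 0" "finite X"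
  shows "worst_case_error (\<chi> i. \<alpha>) (\<chi> i. l)
      (opt_rule (\<chi> i. \<alpha>) (\<chi> i. l) (grid X :: (real ^ 'd) set))
    \<le> sqrt (real CARD('d)) * (LINT x|lborel. power_function l X x * gauss_density \<alpha> x)"
proof -
  let ?k = "gauss_kernel1 l"
  let ?K = "gauss_kernel (\<chi> i. l) :: real ^ 'd \<Rightarrow> real ^ 'd \<Rightarrow> real"
  let ?H = "rkhs_space ?K"
  let ?G = "grid X :: (real ^ 'd) set"
  define ip where "ip = snd (rkhs ?K)"
  interpret reproducing_kernel_hilbert_space ?K ?H ip
    unfolding ip_def by (rule gauss_kernel_rkhs[OF assms(2)])
  obtain m w where
    k_int: "\<forall>x. integrable lborel (\<lambda>t. ?k t x * gauss_density \<alpha> t)" and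
    m_eq: "\<forall>x. m x = (LINT t|lborel. ?k t x * gauss_density \<alpha> t)" and
    m_int: "integrable lborel (\<lambda>x. m x * gauss_density \<alpha> x)" and
    ww: "(\<Sum>x\<in>X. \<Sum>y\<in>X. w x * w y * ?k x y) = (\<Sum>x\<in>X. w x * m x)" and
    bounds: "0 \<le> (\<Sum>x\<in>X. w x * m x)"
      "(\<Sum>x\<in>X. w x * m x) \<le> (LINT x|lborel. m x * gauss_density \<alpha> x)"
      "(LINT x|lborel. m x * gauss_density \<alpha> x) \<le> 1" and
    err: "sqrt ((LINT x|lborel. m x * gauss_density \<alpha> x) - (\<Sum>x\<in>X. w x * m x))
      \<le> (LINT x|lborel. power_function l X x * gauss_density \<alpha> x)"
    by (rule gauss_quadrature_1d[OF assms])
  define a where "a = (LINT x|lborel. m x * gauss_density \<alpha> x)"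
  define b where "b = (\<Sum>x\<in>X. w x * m x)"
  define \<rho> where "\<rho> x = (\<Prod>i\<in>UNIV. gauss_density \<alpha> (x $ i))" for x :: "real ^ 'd"
  define L where "L f = (LINT x|lborel. f x * \<rho> x)" for f
  have \<rho>: "integrable lborel \<rho>" "\<And>x. 0 \<le> \<rho> x" "(LINT x|lborel. \<rho> x) = 1"
    using lborel_integral_prod_vec[of "\<lambda>_::'d. gauss_density \<alpha>"] gauss_density_probability[OF assms(1)]
    by (auto simp: \<rho>_def[abs_def] intro: prod_nonneg)
  have K_self: "?K x x = 1" for x by (simp add: gauss_kernel_prod)
  obtain r where r: "r \<in> ?H" "\<And>f. f \<in> ?H \<Longrightarrow> L f = ip f r"
    using mean_embedding(3)[OF reproducing_kernel_hilbert_space_axioms K_self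
        continuous_gauss_kernel \<rho>] by (auto simp: L_def)
  have L_prod: "L (\<lambda>x. \<Prod>i\<in>UNIV. f i (x $ i)) = (\<Prod>i\<in>UNIV. LINT t|lborel. f i t * gauss_density \<alpha> t)"
    if "\<And>i. integrable lborel (\<lambda>t. f i t * gauss_density \<alpha> t)" for f :: "'d \<Rightarrow> real \<Rightarrow> real"
    using lborel_integral_prod_vec(2)[of "\<lambda>i t. f i t * gauss_density \<alpha> t", OF that]
    by (simp add: L_def \<rho>_def prod.distrib)
  \<comment> \<open>Kernel and density both factor over the coordinates, hence so does the mean
    embedding.\<close>
  have r_eq: "r = (\<lambda>x. \<Prod>i\<in>UNIV. m (x $ i))"
  proof
    fix x
    have "r x = L (\<lambda>y. ?K y x)"
      using reproducing[OF r(1), of x] r(2)[OF kernel_mem] ip_commute[OF kernel_mem r(1)] by simp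
    also have "\<dots> = (\<Prod>i\<in>UNIV. m (x $ i))"
      unfolding gauss_kernel_prod m_eq[rule_format] by (rule L_prod[OF k_int[rule_format]])
    finally show "r x = (\<Prod>i\<in>UNIV. m (x $ i))" .
  qed
  define E where "E v = sqrt (ip (kernel_residual r ?G v) (kernel_residual r ?G v))" for v
  have wce: "worst_case_error (\<chi> i. \<alpha>) (\<chi> i. l) (quad_rule ?G v) = E v" for v
    using SUP_quadrature_error[OF r, where X="?G" and w=v]
    by (simp add: worst_case_error_def rkhs_norm_def ip_def[symmetric] quad_rule_def E_def
        gauss_integral_eq \<rho>_def[symmetric] L_def)
  \<comment> \<open>The optimal rule is specified by choice among minimisers, so one must be
    exhibited before anything is known about it; interpolating weights on the grid provide
    it.\<close>
  obtain v0 where "\<And>v. ip (kernel_residual r ?G v0) (kernel_residual r ?G v0)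
      \<le> ip (kernel_residual r ?G v) (kernel_residual r ?G v)"
    by (rule orthogonal_weights[OF r(1) finite_grid[OF assms(3)]]) blast
  then have "E v0 \<le> E v" for v by (simp add: E_def)
  then have "\<exists>v0. is_arg_min E (\<lambda>_. True) v0" by (auto simp: is_arg_min_def not_less)
  then have "is_arg_min E (\<lambda>_. True) (arg_min E (\<lambda>_. True))" unfolding arg_min_def by (rule someI_ex)
  then have opt: "E (arg_min E (\<lambda>_. True)) \<le> E v" for v by (auto simp: is_arg_min_def not_less)
  \<comment> \<open>For product weights the cross sum and the Gram sum both equal
    \<open>b ^ CARD('d)\<close>; entering the squared error with factors -2 and 1, they leave a
    single subtracted copy.\<close>
  define W where "W x = (\<Prod>i\<in>UNIV. w (x $ i))" for x :: "real ^ 'd"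
  have "ip r r = a ^ CARD('d)"
  proof -
    have "ip r r = L r" using r by simp
    also have "\<dots> = a ^ CARD('d)"
      unfolding r_eq using L_prod[of "\<lambda>_. m", OF m_int] by (simp add: a_def)
    finally show ?thesis .
  qed
  moreover have "(\<Sum>x\<in>?G. W x * r x) = b ^ CARD('d)"
    using sum_grid_prod[OF assms(3), of "\<lambda>(_::'d) t. w t * m t"]
    by (simp add: W_def r_eq prod.distrib b_def)
  moreover have "(\<Sum>x\<in>?G. \<Sum>y\<in>?G. W x * W y * ?K x y) = b ^ CARD('d)"
  proof -
    have "(\<Sum>y\<in>?G. W x * W y * ?K x y) = (\<Prod>i\<in>UNIV. \<Sum>t\<in>X. w (x $ i) * w t * ?k (x $ i) t)" for x
      using sum_grid_prod[OF assms(3), of "\<lambda>i t. w (x $ i) * w t * ?k (x $ i) t"]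
      by (simp add: W_def gauss_kernel_prod prod.distrib)
    then have "(\<Sum>x\<in>?G. \<Sum>y\<in>?G. W x * W y * ?K x y) =
        (\<Prod>i\<in>(UNIV::'d set). \<Sum>s\<in>X. \<Sum>t\<in>X. w s * w t * ?k s t)"
      using sum_grid_prod[OF assms(3), of "\<lambda>(i::'d) s. \<Sum>t\<in>X. w s * w t * ?k s t"] by simp
    then show ?thesis by (simp add: ww b_def)
  qed
  ultimately have "E W = sqrt (a ^ CARD('d) - b ^ CARD('d))"
    unfolding E_def ip_kernel_residual[OF r(1)] by simp
  also have "\<dots> \<le> sqrt (real CARD('d) * (a - b))"
    using bounds by (intro real_sqrt_le_mono power_diff_le) (auto simp: a_def b_def)
  also have "\<dots> \<le> sqrt (real CARD('d)) * (LINT x|lborel. power_function l X x * gauss_density \<alpha> x)"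
    using err by (simp add: real_sqrt_mult a_def b_def mult_left_mono)
  finally show ?thesis using opt[of W] by (simp add: opt_rule_def wce)
qed

section \<open>The point sets and their fill distances\<close>

lemma fill_distance_leI:
  assumes "finite X" "\<Omega> \<noteq> {}" "\<And>x. x \<in> \<Omega> \<Longrightarrow> \<exists>y\<in>X \<inter> \<Omega>. \<bar>x - y\<bar> \<le> \<delta>"
  shows "fill_distance X \<Omega> \<le> ereal \<delta>"
proof -
  have "X \<inter> \<Omega> \<noteq> {}" using assms(2,3) by blast
  moreover have "Min ((\<lambda>y. \<bar>x - y\<bar>) ` (X \<inter> \<Omega>)) \<le> \<delta>" if "x \<in> \<Omega>" for x
    using assms(1) assms(3)[OF that] by (subst Min_le_iff) auto
  ultimately show ?thesis by (auto simp: fill_distance_def intro!: SUP_least)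
qed

lemma fill_distance_leD:
  assumes "finite X" "fill_distance X \<Omega> \<le> ereal \<delta>" "x \<in> \<Omega>"
  shows "\<exists>y\<in>X \<inter> \<Omega>. \<bar>x - y\<bar> \<le> \<delta>"
proof -
  have ne: "X \<inter> \<Omega> \<noteq> {}" using assms(2) by (auto simp: fill_distance_def)
  have "ereal (Min ((\<lambda>y. \<bar>x - y\<bar>) ` (X \<inter> \<Omega>))) \<le> fill_distance X \<Omega>"
    using ne assms(3) by (auto simp: fill_distance_def intro: SUP_upper)
  then have "Min ((\<lambda>y. \<bar>x - y\<bar>) ` (X \<inter> \<Omega>)) \<le> \<delta>"
    using assms(2) by (metis ereal_less_eq(3) order_trans)
  then show ?thesis using ne assms(1) by (subst (asm) Min_le_iff) auto
qed

text \<open>Fill distance 0 would place a whole interval inside a finite set. Positivity is needed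
  for the logarithm and the inverse in the power bound.\<close>

lemma fill_distance_pos:
  assumes "finite X" "a < b"
  shows "0 < fill_distance X {a..b}"
proof (rule ccontr)
  assume "\<not> 0 < fill_distance X {a..b}"
  then have "fill_distance X {a..b} \<le> ereal 0" by (simp add: not_less zero_ereal_def)
  then have "{a..b} \<subseteq> X" using fill_distance_leD[OF assms(1)] by fastforce
  then show False using assms infinite_Icc[of a b] finite_subset by blast
qed

text \<open>The points fill an open interval but the closed one is required. Approximating a point
  from inside costs an extra e, which finiteness of Z allows to be sent to 0.\<close>

lemma fill_distance_shift:
  assumes "finite Z" "Z \<subseteq> {0<..<1}" "fill_distance Z {0<..<1} \<le> ereal \<delta>"
    and "finite X" "(\<lambda>y. y + s) ` Z \<subseteq> X"
  shows "fill_distance X {s..s + 1} \<le> ereal \<delta>"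
proof (rule fill_distance_leI[OF assms(4)])
  fix x assume x: "x \<in> {s..s + 1}"
  define u where "u = x - s"
  have u: "0 \<le> u" "u \<le> 1" using x by (auto simp: u_def)
  have Z_ne: "Z \<noteq> {}"
    using fill_distance_leD[OF assms(1,3), of "1/2"] by auto
  have "Min ((\<lambda>y. \<bar>u - y\<bar>) ` Z) \<le> \<delta> + e" if "e > 0" for e
  proof -
    \<comment> \<open>Nudges \<open>u\<close> inwards by at most e / 2, capped at 1 / 4 so that
      \<open>t\<close> stays in the open unit interval.\<close>
    define t where "t = (if u < 1/2 then u + min e (1/2) / 2 else u - min e (1/2) / 2)"
    have "t \<in> {0<..<1}" "\<bar>u - t\<bar> \<le> e"
      using u that by (auto simp: t_def min_def)
    with fill_distance_leD[OF assms(1,3)] obtain y where "y \<in> Z" "\<bar>t - y\<bar> \<le> \<delta>" by blast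
    then have "\<bar>u - y\<bar> \<le> \<delta> + e" using \<open>\<bar>u - t\<bar> \<le> e\<close> by linarith
    then show ?thesis using assms(1) Z_ne \<open>y \<in> Z\<close> by (subst Min_le_iff) auto
  qed
  then have "Min ((\<lambda>y. \<bar>u - y\<bar>) ` Z) \<le> \<delta>" by (rule field_le_epsilon)
  then obtain y where y: "y \<in> Z" "\<bar>u - y\<bar> \<le> \<delta>"
    using assms(1) Z_ne by (subst (asm) Min_le_iff) auto
  have "y + s \<in> X \<inter> {s..s + 1}" using y(1) assms(2,5) by (auto simp: subset_iff)
  moreover have "\<bar>x - (y + s)\<bar> \<le> \<delta>" using y(2) by (simp add: u_def algebra_simps)
  ultimately show "\<exists>y\<in>X \<inter> {s..s + 1}. \<bar>x - y\<bar> \<le> \<delta>" by blast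
qed auto

lemma shift_pos_subset_nodes: "1 \<le> m \<Longrightarrow> m \<le> k \<Longrightarrow> shift_pos Y (k - m + 1) m \<subseteq> nodes Y k"
  and shift_neg_subset_nodes: "1 \<le> m \<Longrightarrow> m \<le> k \<Longrightarrow> shift_neg Y (k - m + 1) m \<subseteq> nodes Y k"
  by (auto simp: nodes_def)

lemma finite_nodes: "admissible_sequence c Y \<Longrightarrow> finite (nodes Y k)"
  by (auto simp: nodes_def shift_pos_def shift_neg_def admissible_sequence_def)

text \<open>Block m lives where m - 1 < |x| < m, so distinct blocks are disjoint, and its two halves
  are separated by sign. The block sizes 2 * (k - m + 1) add up to twice a triangular
  number.\<close>

lemma card_nodes:
  assumes "admissible_sequence c Y"
  shows "card (nodes Y k) = k * (k + 1)"
proof -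
  have Y: "Y p \<subseteq> {0<..<1}" "finite (Y p)" "card (Y p) = p" if "p \<ge> 1" for p
    using assms that by (auto simp: admissible_sequence_def)
  let ?S = "\<lambda>m. shift_pos Y (k - m + 1) m \<union> shift_neg Y (k - m + 1) m"
  have fin: "finite (shift_pos Y p m)" "finite (shift_neg Y p m)" if "p \<ge> 1" for p m
    using Y[OF that] by (auto simp: shift_pos_def shift_neg_def)
  have abs: "real m - 1 < \<bar>x\<bar> \<and> \<bar>x\<bar> < real m" if "x \<in> ?S m" "m \<ge> 1" for m x
    using that Y(1)[of "k - m + 1"] by (auto simp: shift_pos_def shift_neg_def subset_iff)
  have card: "card (?S m) = 2 * (k - m + 1)" if "m \<ge> 1" for m
  proof -
    have "shift_pos Y (k - m + 1) m \<inter> shift_neg Y (k - m + 1) m = {}"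
    proof (rule equals0I)
      fix x assume "x \<in> shift_pos Y (k - m + 1) m \<inter> shift_neg Y (k - m + 1) m"
      then have "real m - 1 < x" "x < 1 - real m"
        using Y(1)[of "k - m + 1"] by (auto simp: shift_pos_def shift_neg_def subset_iff)
      then show False using that by simp
    qed
    moreover have "card (shift_pos Y (k - m + 1) m) = k - m + 1"
      "card (shift_neg Y (k - m + 1) m) = k - m + 1"
      using Y(3)[of "k - m + 1"] by (auto simp: shift_pos_def shift_neg_def card_image inj_on_def)
    ultimately show ?thesis using fin by (subst card_Un_disjoint) auto
  qed
  have "card (nodes Y k) = (\<Sum>m\<in>{1..k}. card (?S m))"
    unfolding nodes_def
  proof (rule card_UN_disjoint)
    show "\<forall>m\<in>{1..k}. \<forall>n\<in>{1..k}. m \<noteq> n \<longrightarrow> ?S m \<inter> ?S n = {}"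
    proof (intro ballI impI equals0I)
      fix m n x assume mn: "m \<in> {1..k}" "n \<in> {1..k}" "m \<noteq> n" and x: "x \<in> ?S m \<inter> ?S n"
      then have "real m - 1 < real n" "real n - 1 < real m" using abs[of x m] abs[of x n] by auto
      then show False using mn(3) by linarith
    qed
  qed (use fin in auto)
  also have "\<dots> = (\<Sum>m\<in>{1..k}. 2 * (k - m + 1))" using card by (intro sum.cong) auto
  also have "\<dots> = (\<Sum>j\<in>{1..k}. 2 * j)"
    by (rule sum.reindex_bij_witness[of _ "\<lambda>j. k + 1 - j" "\<lambda>m. k + 1 - m"]) auto
  also have "\<dots> = k * (k + 1)" by (induction k) auto
  finally show ?thesis .
qed

text \<open>In the inner half of the blocks, m \<le> k / 2, the copied set has p = k - m + 1 > k / 2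
  points, which costs only a factor 2 in the fill distance.\<close>

lemma fill_distance_nodes:
  assumes Y: "admissible_sequence c Y" and "c > 0" and a: "- int (k div 2) \<le> a" "a < int (k div 2)"
  shows "fill_distance (nodes Y k) {real_of_int a..real_of_int a + 1} \<le> ereal (2 * c / real k)"
proof -
  \<comment> \<open>The unit interval starting at a \<ge> 0 holds the positive half of block a + 1;
    for a < 0 it holds the negative half of block - a.\<close>
  define m where "m = nat (if 0 \<le> a then a + 1 else - a)"
  define p where "p = k - m + 1"
  have m: "1 \<le> m" "m \<le> k div 2" using a by (auto simp: m_def)
  have mk: "m \<le> k" using m by linarith
  have k: "k \<ge> 1" using m by linarith
  have p: "p \<ge> 1" "real k \<le> 2 * real p" using m by (auto simp: p_def)
  have Yp: "Y p \<subseteq> {0<..<1}" "finite (Y p)" "fill_distance (Y p) {0<..<1} \<le> ereal (c / real p)"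
    using Y p(1) by (auto simp: admissible_sequence_def)
  have "(\<lambda>y. y + real_of_int a) ` Y p \<subseteq> nodes Y k"
  proof (cases "0 \<le> a")
    case True
    then have "(\<lambda>y. y + real_of_int a) ` Y p = shift_pos Y p m"
      by (auto simp: shift_pos_def m_def)
    then show ?thesis using shift_pos_subset_nodes[OF m(1) mk, of Y] by (simp add: p_def)
  next
    case False
    then have "(\<lambda>y. y + real_of_int a) ` Y p = shift_neg Y p m"
      by (auto simp: shift_neg_def m_def)
    then show ?thesis using shift_neg_subset_nodes[OF m(1) mk, of Y] by (simp add: p_def)
  qed
  from fill_distance_shift[OF Yp(2,1,3) finite_nodes[OF Y] this]
  have "fill_distance (nodes Y k) {real_of_int a..real_of_int a + 1} \<le> ereal (c / real p)" .
  also have "c / real p \<le> 2 * c / real k"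
    using p k \<open>c > 0\<close> by (simp add: field_simps)
  finally show ?thesis by simp
qed

text \<open>On (0, 1] both - ln and the inverse are nonnegative and decreasing. This lets an upper
  bound replace the fill distance in the exponent.\<close>

lemma inverse_ln_mono:
  fixes f h :: real
  assumes "0 < f" "f \<le> h" "h \<le> 1"
  shows "ln f * inverse f \<le> ln h * inverse h"
proof -
  have "(- ln h) * inverse h \<le> (- ln f) * inverse f"
    using assms by (intro mult_mono) (auto simp: le_imp_inverse_le)
  then show ?thesis by simp
qed

text \<open>The first exponent decays like - k log k and the second like - k^2, so both terms beat
  every exponential in k. Boundedness of a convergent sequence absorbs the small k into C.\<close>

lemma superexponential_bound:
  fixes A c \<alpha> b q :: real
  assumes "A > 0" "c > 0" "\<alpha> > 0" "b > 0" "q > 0"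
  obtains C where "C > 0" "\<And>k. (2 * q * real k * exp (A * (ln (2 * c / real k) * inverse (2 * c / real k)))
      + sqrt 2 * exp (- (real k - 1)\<^sup>2 / (16 * \<alpha>\<^sup>2))) \<le> C * exp (- b * (real k + 1))"
proof -
  let ?G = "\<lambda>k::nat. 2 * q * real k * exp (A * (ln (2 * c / real k) * inverse (2 * c / real k)))
      + sqrt 2 * exp (- (real k - 1)\<^sup>2 / (16 * \<alpha>\<^sup>2))"
  have "(\<lambda>k. ?G k * exp (b * (real k + 1))) \<longlonglongrightarrow> 0"
    using assms by real_asymp
  from convergent_imp_Bseq[OF convergentI[OF this]]
  obtain C where C: "C > 0" "\<forall>k. norm (?G k * exp (b * (real k + 1))) \<le> C"
    by (rule BseqE)
  have "?G k \<le> C * exp (- b * (real k + 1))" for k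
  proof -
    have "?G k = (?G k * exp (b * (real k + 1))) * exp (- b * (real k + 1))"
      by (simp add: mult.assoc flip: exp_add)
    also have "\<dots> \<le> C * exp (- b * (real k + 1))"
      using spec[OF C(2), of k] by (intro mult_right_mono) auto
    finally show ?thesis .
  qed
  with C(1) that show ?thesis by blast
qed

section \<open>The convergence rate\<close>

lemma integral_power_function_gauss_le:
  assumes "\<alpha> > 0" "l > 0"
    and B: "\<And>a. \<lbrakk>- int M \<le> a; a < int M\<rbrakk> \<Longrightarrow>
      (LBINT x:{real_of_int a..real_of_int a + 1}. power_function l X x) \<le> B"
  shows "(LINT x|lborel. power_function l X x * gauss_density \<alpha> x)
    \<le> 2 * real M * B / (sqrt (2 * pi) * \<alpha>) + sqrt 2 * exp (- (real M)\<^sup>2 / (4 * \<alpha>\<^sup>2))"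
proof -
  define S where "S = {- int M..<int M}"
  define q where "q = 1 / (sqrt (2 * pi) * \<alpha>)"
  let ?P = "power_function l X"
  let ?J = "\<lambda>a. indicator {real_of_int a..real_of_int a + 1} :: real \<Rightarrow> real"
  \<comment> \<open>Outside [-M, M] half of the Gaussian exponent pays for the factor in M. The
    other half is a Gaussian of standard deviation \<open>sqrt 2 * \<alpha>\<close>, whose
    normalisation accounts for \<open>sqrt 2\<close>.\<close>
  let ?tail = "\<lambda>x. sqrt 2 * exp (- (real M)\<^sup>2 / (4 * \<alpha>\<^sup>2)) * gauss_density (sqrt 2 * \<alpha>) x"
  let ?F = "\<lambda>x. (\<Sum>a\<in>S. q * (?J a x * ?P x)) + ?tail x"
  have q: "q > 0" using assms(1) by (simp add: q_def)
  note P = power_function_bounds_measurable[OF assms(2)]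
  have wide: "integrable lborel (gauss_density (sqrt 2 * \<alpha>))"
    "(LINT x|lborel. gauss_density (sqrt 2 * \<alpha>) x) = 1"
    "\<And>x. 0 \<le> gauss_density (sqrt 2 * \<alpha>) x"
    using gauss_density_probability[of "sqrt 2 * \<alpha>"] assms(1) by auto
  have JP: "integrable lborel (\<lambda>x. ?J a x * ?P x)" for a
  proof (rule Bochner_Integration.integrable_bound)
    show "integrable lborel (?J a)" by simp
    show "(\<lambda>x. ?J a x * ?P x) \<in> borel_measurable lborel" using P(3) by simp
    show "AE x in lborel. norm (?J a x * ?P x) \<le> norm (?J a x)"
      using P(1,2) by (intro always_eventually) (auto simp: indicator_def)
  qed
  \<comment> \<open>A central point is charged to the interval starting at its floor, with the
    density bounded by its peak \<open>q\<close>; that the closed intervals share endpoints only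
    enlarges the majorant.\<close>
  have pointwise: "?P x * gauss_density \<alpha> x \<le> ?F x" for x
  proof (cases "\<lfloor>x\<rfloor> \<in> S")
    case True
    have "?P x * gauss_density \<alpha> x \<le> ?P x * q"
      using assms(1) P(1) by (intro mult_left_mono) (auto simp: gauss_density_def q_def divide_simps)
    also have "\<dots> = q * (?J \<lfloor>x\<rfloor> x * ?P x)" by (simp add: indicator_def)
    also have "\<dots> \<le> (\<Sum>a\<in>S. q * (?J a x * ?P x))"
      using True P(1) q by (intro member_le_sum) (auto simp: S_def)
    also have "\<dots> \<le> ?F x" using wide(3) by simp
    finally show ?thesis .
  next
    case False
    then have "real M \<le> \<bar>x\<bar>" by (auto simp: S_def not_le not_less) linarith+
    then have "(real M)\<^sup>2 \<le> x\<^sup>2" by (metis abs_le_square_iff abs_of_nat)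
    then have "- x\<^sup>2 / (2 * \<alpha>\<^sup>2) \<le> - (real M)\<^sup>2 / (4 * \<alpha>\<^sup>2) + - x\<^sup>2 / (2 * (sqrt 2 * \<alpha>)\<^sup>2)"
      using assms(1) by (simp add: power_mult_distrib field_simps)
    then have "exp (- x\<^sup>2 / (2 * \<alpha>\<^sup>2))
        \<le> exp (- (real M)\<^sup>2 / (4 * \<alpha>\<^sup>2)) * exp (- x\<^sup>2 / (2 * (sqrt 2 * \<alpha>)\<^sup>2))"
      by (simp flip: exp_add)
    then have "gauss_density \<alpha> x \<le> ?tail x"
      using assms(1) by (simp add: gauss_density_def divide_right_mono)
    then have "?P x * gauss_density \<alpha> x \<le> 1 * ?tail x"
      using P(1,2) gauss_density_probability(3)[OF assms(1)] by (intro mult_mono) auto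
    moreover have "0 \<le> (\<Sum>a\<in>S. q * (?J a x * ?P x))"
      using P(1) q by (intro sum_nonneg) auto
    ultimately show ?thesis by simp
  qed
  have F: "integrable lborel ?F"
    using JP wide(1) by (intro Bochner_Integration.integrable_add Bochner_Integration.integrable_sum) auto
  have "(LINT x|lborel. ?P x * gauss_density \<alpha> x) \<le> (LINT x|lborel. ?F x)"
    using pointwise F integrable_power_function_gauss[OF assms(1,2)] by (intro integral_mono) auto
  also have "\<dots> = (\<Sum>a\<in>S. q * (LINT x|lborel. ?J a x * ?P x)) + sqrt 2 * exp (- (real M)\<^sup>2 / (4 * \<alpha>\<^sup>2))"
    using JP wide(1,2) by (subst Bochner_Integration.integral_add) (auto simp: Bochner_Integration.integral_sum)
  also have "(\<Sum>a\<in>S. q * (LINT x|lborel. ?J a x * ?P x)) \<le> (\<Sum>a\<in>S. q * B)"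
  proof (intro sum_mono mult_left_mono)
    show "(LINT x|lborel. ?J a x * ?P x) \<le> B" if "a \<in> S" for a
      using B[of a] that by (simp add: S_def set_lebesgue_integral_def)
  qed (use q in simp)
  also have "(\<Sum>a\<in>S. q * B) = 2 * real M * B / (sqrt (2 * pi) * \<alpha>)"
    by (simp add: S_def q_def)
  finally show ?thesis by simp
qed

theorem corollary3p5:
  fixes A h\<^sub>0 :: "real \<Rightarrow> real"
    and \<alpha> l c :: real
  assumes constants: "\<And>l. l > 0 \<Longrightarrow> A l > 0 \<and> 0 < h\<^sub>0 l \<and> h\<^sub>0 l \<le> 1"
    and power_bound:
      "\<And>l a X. \<lbrakk>l > 0; finite X; fill_distance X {a..a + 1} \<le> ereal (h\<^sub>0 l)\<rbrakk> \<Longrightarrow>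
         (LBINT x:{a..a + 1}. power_function l X x)
           \<le> exp (A l * ln (real_of_ereal (fill_distance X {a..a + 1}))
                      * inverse (real_of_ereal (fill_distance X {a..a + 1})))"
    and "\<alpha> > 0" "l > 0" "c > 0"
  shows "\<exists>C>0. \<forall>Y k. admissible_sequence c Y \<longrightarrow> k \<ge> 1 \<longrightarrow>
           card (nodes Y k) = k * (k + 1) \<and>
           (real k \<ge> 2 * c * inverse (min (h\<^sub>0 l) (inverse c)) \<longrightarrow>
             worst_case_error (\<chi> i. \<alpha>) (\<chi> i. l)
               (opt_rule (\<chi> i. \<alpha>) (\<chi> i. l) (grid (nodes Y k) :: (real ^ 'd) set))
             \<le> C * exp (- sqrt (real (card (nodes Y k))) / (2 * sqrt 2 * \<alpha>\<^sup>2)))"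
proof -
  \<comment> \<open>\<open>b\<close> is the target rate, \<open>q\<close> the peak of the density,
    and \<open>D k\<close> the exponent of the power bound at fill distance 2 * c / k.\<close>
  define b where "b = 1 / (2 * sqrt 2 * \<alpha>\<^sup>2)"
  define q where "q = 1 / (sqrt (2 * pi) * \<alpha>)"
  define D where "D k = A l * (ln (2 * c / real k) * inverse (2 * c / real k))" for k
  have pos: "A l > 0" "b > 0" "q > 0" using constants[of l] assms(3,4) by (auto simp: b_def q_def)
  \<comment> \<open>The constant is fixed before Y and k appear, and from \<open>A l\<close>,
    \<open>c\<close> and \<open>\<alpha>\<close> alone.\<close>
  obtain C where C: "C > 0" "\<And>k. 2 * q * real k * exp (D k)
      + sqrt 2 * exp (- (real k - 1)\<^sup>2 / (16 * \<alpha>\<^sup>2)) \<le> C * exp (- b * (real k + 1))"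
    using superexponential_bound[OF pos(1) \<open>c > 0\<close> \<open>\<alpha> > 0\<close> pos(2,3)] unfolding D_def by blast
  have "worst_case_error (\<chi> i. \<alpha>) (\<chi> i. l)
      (opt_rule (\<chi> i. \<alpha>) (\<chi> i. l) (grid (nodes Y k) :: (real ^ 'd) set))
    \<le> sqrt (real CARD('d)) * C * exp (- sqrt (real (card (nodes Y k))) / (2 * sqrt 2 * \<alpha>\<^sup>2))"
    if Y: "admissible_sequence c Y" and k: "k \<ge> 1"
      "real k \<ge> 2 * c * inverse (min (h\<^sub>0 l) (inverse c))" for Y k
  proof -
    define X where "X = nodes Y k"
    define M where "M = k div 2"
    have X: "finite X" unfolding X_def by (rule finite_nodes[OF Y])
    define h where "h = min (h\<^sub>0 l) (inverse c)"
    have h: "0 < h" "h \<le> h\<^sub>0 l" "h \<le> 1"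
      using constants[OF \<open>l > 0\<close>] \<open>c > 0\<close> by (auto simp: h_def)
    \<comment> \<open>The threshold on k puts 2 * c / k below \<open>h\<^sub>0 l\<close>, where the
      power bound is available, and below 1, where \<open>inverse_ln_mono\<close> applies.\<close>
    have H: "2 * c / real k \<le> h"
      using k(1) k(2)[folded h_def] h(1) by (simp add: field_simps)
    have "(LBINT x:{real_of_int a..real_of_int a + 1}. power_function l X x) \<le> exp (D k)"
      if a: "- int M \<le> a" "a < int M" for a
    proof -
      let ?f = "fill_distance X {real_of_int a..real_of_int a + 1}"
      have f_le: "?f \<le> ereal (2 * c / real k)"
        unfolding X_def using fill_distance_nodes[OF Y \<open>c > 0\<close>] a by (simp add: M_def)
      have "0 < ?f" by (rule fill_distance_pos[OF X]) simp
      with f_le obtain f where f: "?f = ereal f" "0 < f" "f \<le> 2 * c / real k"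
        by (cases ?f) auto
      have "(LBINT x:{real_of_int a..real_of_int a + 1}. power_function l X x)
          \<le> exp (A l * ln f * inverse f)"
        using power_bound[OF \<open>l > 0\<close> X, of "real_of_int a"] f H h(2) by simp
      also have "\<dots> \<le> exp (D k)"
        using mult_left_mono[OF inverse_ln_mono[OF f(2,3) order_trans[OF H h(3)]], of "A l"] pos(1)
        by (simp only: D_def exp_le_cancel_iff mult.assoc less_imp_le)
      finally show ?thesis .
    qed
    then have "(LINT x|lborel. power_function l X x * gauss_density \<alpha> x)
        \<le> 2 * real M * exp (D k) / (sqrt (2 * pi) * \<alpha>) + sqrt 2 * exp (- (real M)\<^sup>2 / (4 * \<alpha>\<^sup>2))"
      by (rule integral_power_function_gauss_le[OF \<open>\<alpha> > 0\<close> \<open>l > 0\<close>])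
    also have "\<dots> = 2 * q * real M * exp (D k) + sqrt 2 * exp (- (real M)\<^sup>2 / (4 * \<alpha>\<^sup>2))"
      by (simp add: q_def)
    also have "\<dots> \<le> 2 * q * real k * exp (D k) + sqrt 2 * exp (- (real k - 1)\<^sup>2 / (16 * \<alpha>\<^sup>2))"
    proof (intro add_mono mult_right_mono mult_left_mono)
      \<comment> \<open>Halving k with rounding loses at most one, which is the origin of (k - 1)^2
        / 16 in place of M^2 / 4.\<close>
      have "real k - 1 \<le> 2 * real M" unfolding M_def by linarith
      then have "(real k - 1)\<^sup>2 \<le> (2 * real M)\<^sup>2" using k(1) by (intro power_mono) auto
      then have "(real k - 1)\<^sup>2 * 4 \<le> (real M)\<^sup>2 * 16" by (simp add: power_mult_distrib)
      then show "exp (- (real M)\<^sup>2 / (4 * \<alpha>\<^sup>2)) \<le> exp (- (real k - 1)\<^sup>2 / (16 * \<alpha>\<^sup>2))"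
        using \<open>\<alpha> > 0\<close> by (simp add: field_simps)
    qed (use pos in \<open>auto simp: M_def\<close>)
    also have "\<dots> \<le> C * exp (- b * (real k + 1))" by (rule C(2))
    also have "\<dots> \<le> C * exp (- sqrt (real (card X)) / (2 * sqrt 2 * \<alpha>\<^sup>2))"
    proof (intro mult_left_mono)
      \<comment> \<open>Since n = k * (k + 1) \<le> (k + 1)^2, exponential decay in k + 1 gives the
        same rate in sqrt n.\<close>
      have "real (card X) \<le> (real k + 1)\<^sup>2"
        unfolding X_def card_nodes[OF Y] by (simp add: power2_eq_square algebra_simps)
      then have "sqrt (real (card X)) \<le> sqrt ((real k + 1)\<^sup>2)" by (rule real_sqrt_le_mono)
      then have "b * sqrt (real (card X)) \<le> b * (real k + 1)" using pos(2) by simp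
      then show "exp (- b * (real k + 1)) \<le> exp (- sqrt (real (card X)) / (2 * sqrt 2 * \<alpha>\<^sup>2))"
        by (simp add: b_def)
    qed (use C(1) in simp)
    finally have "sqrt (real CARD('d)) * (LINT x|lborel. power_function l X x * gauss_density \<alpha> x)
        \<le> sqrt (real CARD('d)) * (C * exp (- sqrt (real (card X)) / (2 * sqrt 2 * \<alpha>\<^sup>2)))"
      by (rule mult_left_mono) simp
    from order_trans[OF worst_case_error_opt_rule_le[OF \<open>\<alpha> > 0\<close> \<open>l > 0\<close> X] this]
    show ?thesis by (simp only: X_def mult.assoc)
  qed
  moreover have "sqrt (real CARD('d)) * C > 0" using C(1) by simp
  ultimately show ?thesis using card_nodes by blast
qed

end
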